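(* Let $k$ be a field, let $A$ be an affine $k$-domain, and let $n=\dim_k A$. The following conditions are equivalent: (1) $A\in\mathcal{U}_k(n,\mathbf{G})$ (that is, $A$ is a unique factorization domain which admits a positive $\mathbb{Z}$-grading over $k$), and $A^{[m]}\cong_k k^{[n+m]}$ for some $m\in\mathbb{N}$. (2) $A\cong_k k^{[n]}$.
   Context: An affine $k$-domain is an integral domain that is finitely generated as a $k$-algebra. For a ring $R$, $R^{[m]}$ denotes the polynomial ring in $m$ variables over $R$. The symbol $\cong_k$ denotes isomorphism of $k$-algebras. $\mathcal{U}_k(n,\mathbf{G})$ denotes the set of $k$-isomorphism classes of unique factorization domains containing $k$, of transcendence degree $n$ over $k$, which admit a positive $\mathbb{Z}$-grading over $k$. A $\mathbb{Z}$-grading $A=\bigoplus_{i\in\mathbb{Z}}A_i$ over $k$ (so $k\subset A_0$) is positive if $A_i=\{0\}$ for $i<0$ and $A_0=k$. $\mathbb{N}$ denotes the non-negative integers. *)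

theory Defs
  imports
    "HOL-Library.Poly_Mapping"
    "HOL-Library.Multiset"
    "HOL-Library.Extended_Nat"
    "HOL-Computational_Algebra.Factorial_Ring"
begin

text \<open>
  A commutative \<open>k\<close>-algebra is a type \<open>'a\<close> with its structure map \<open>'k \<Rightarrow> 'a\<close>, where \<open>k\<close> is
  the field \<open>'k\<close>. When \<open>'a\<close> is a domain the structure map is injective and \<open>k\<close> is identified
  with its range.
\<close>

definition structure_map :: "('k::comm_ring_1 \<Rightarrow> 'a::comm_ring_1) \<Rightarrow> bool" where
  "structure_map \<phi> \<longleftrightarrow>
     \<phi> 1 = 1 \<and> (\<forall>c d. \<phi> (c + d) = \<phi> c + \<phi> d) \<and> (\<forall>c d. \<phi> (c * d) = \<phi> c * \<phi> d)"

subsection \<open>Polynomial rings in finitely many variables\<close>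

text \<open>
  The type \<open>(nat \<Rightarrow>\<^sub>0 nat) \<Rightarrow>\<^sub>0 'r\<close> with its library ring structure (convolution product) is the
  polynomial ring over \<open>'r\<close> in the variables \<open>X\<^sub>0, X\<^sub>1, \<dots>\<close>. The ring in \<open>m\<close> variables is the
  subring of those polynomials in which only variables with index below \<open>m\<close> occur.
\<close>

type_synonym 'r mpoly = "(nat \<Rightarrow>\<^sub>0 nat) \<Rightarrow>\<^sub>0 'r"

definition poly_ring :: "nat \<Rightarrow> 'r::comm_ring_1 mpoly set" where
  "poly_ring m = {p. \<forall>t \<in> Poly_Mapping.keys p. Poly_Mapping.keys t \<subseteq> {..<m}}"

definition const_poly :: "'r::comm_ring_1 \<Rightarrow> 'r mpoly" where
  "const_poly r = Poly_Mapping.single 0 r"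

definition eval_poly ::
  "('k::comm_ring_1 \<Rightarrow> 'a::comm_ring_1) \<Rightarrow> (nat \<Rightarrow> 'a) \<Rightarrow> 'k mpoly \<Rightarrow> 'a" where
  "eval_poly \<phi> x p =
     (\<Sum>t \<in> Poly_Mapping.keys p. \<phi> (Poly_Mapping.lookup p t) * (\<Prod>i \<in> Poly_Mapping.keys t. x i ^ Poly_Mapping.lookup t i))"

subsection \<open>Isomorphisms, affine domains, transcendence degree\<close>

text \<open>
  Isomorphism of the \<open>k\<close>-algebras carried by the subrings \<open>S\<close> and \<open>T\<close>, with structure maps \<open>\<phi>\<close>
  and \<open>\<psi>\<close>. That \<open>f\<close> preserves 1 follows from \<open>f (\<phi> 1) = \<psi> 1\<close>.
\<close>

definition k_isomorphic ::
  "'b::comm_ring_1 set \<Rightarrow> ('k::comm_ring_1 \<Rightarrow> 'b) \<Rightarrow> 'c::comm_ring_1 set \<Rightarrow> ('k \<Rightarrow> 'c) \<Rightarrow> bool" where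
  "k_isomorphic S \<phi> T \<psi> \<longleftrightarrow>
     (\<exists>f. bij_betw f S T \<and>
          (\<forall>x \<in> S. \<forall>y \<in> S. f (x + y) = f x + f y) \<and>
          (\<forall>x \<in> S. \<forall>y \<in> S. f (x * y) = f x * f y) \<and>
          (\<forall>c. f (\<phi> c) = \<psi> c))"

definition affine_domain :: "('k::field \<Rightarrow> 'a::idom) \<Rightarrow> bool" where
  "affine_domain \<phi> \<longleftrightarrow>
     structure_map \<phi> \<and> (\<exists>r x. \<forall>a. \<exists>p \<in> poly_ring r. eval_poly \<phi> x p = a)"

definition alg_independent :: "('k::field \<Rightarrow> 'a::idom) \<Rightarrow> nat \<Rightarrow> (nat \<Rightarrow> 'a) \<Rightarrow> bool" where
  "alg_independent \<phi> d x \<longleftrightarrow> (\<forall>p \<in> poly_ring d. eval_poly \<phi> x p = 0 \<longrightarrow> p = 0)"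

text \<open>The maximal length of an algebraically independent family, infinite if there is none.\<close>

definition tr_deg :: "('k::field \<Rightarrow> 'a::idom) \<Rightarrow> enat" where
  "tr_deg \<phi> = Sup {enat d | d. \<exists>x. alg_independent \<phi> d x}"

subsection \<open>Unique factorization domains\<close>

text \<open>
  The library class \<open>factorial_semiring\<close> cannot be used as a condition inside a formula, and it
  also fixes a choice of normal forms for associates. The second conjunct says that any two
  factorizations into irreducibles of the same element match bijectively up to associates.
\<close>

definition ufd :: "'a::idom itself \<Rightarrow> bool" where
  "ufd _ \<longleftrightarrow>
     (\<forall>a::'a. a \<noteq> 0 \<and> \<not> a dvd 1 \<longrightarrow> (\<exists>M. (\<forall>p \<in># M. irreducible p) \<and> a = prod_mset M)) \<and>
     (\<forall>M N :: 'a multiset.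
        (\<forall>p \<in># M. irreducible p) \<and> (\<forall>q \<in># N. irreducible q) \<and> prod_mset M = prod_mset N \<longrightarrow>
        rel_mset (\<lambda>p q. p dvd q \<and> q dvd p) M N)"

subsection \<open>Gradings\<close>

text \<open>
  The third conjunct is directness together with spanning. Finitely supported families of
  elements are modelled as \<open>int \<Rightarrow>\<^sub>0 'a\<close>.
\<close>

definition Z_grading :: "('k::field \<Rightarrow> 'a::idom) \<Rightarrow> (int \<Rightarrow> 'a set) \<Rightarrow> bool" where
  "Z_grading \<phi> G \<longleftrightarrow>
     (\<forall>i. 0 \<in> G i \<and> (\<forall>a \<in> G i. \<forall>b \<in> G i. a - b \<in> G i)) \<and>
     (\<forall>i j. \<forall>a \<in> G i. \<forall>b \<in> G j. a * b \<in> G (i + j)) \<and>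
     (\<forall>a. \<exists>!h :: int \<Rightarrow>\<^sub>0 'a. (\<forall>i. Poly_Mapping.lookup h i \<in> G i) \<and> a = (\<Sum>i \<in> Poly_Mapping.keys h. Poly_Mapping.lookup h i)) \<and>
     range \<phi> \<subseteq> G 0"

definition positive_Z_grading :: "('k::field \<Rightarrow> 'a::idom) \<Rightarrow> (int \<Rightarrow> 'a set) \<Rightarrow> bool" where
  "positive_Z_grading \<phi> G \<longleftrightarrow> Z_grading \<phi> G \<and> (\<forall>i < 0. G i = {0}) \<and> G 0 = range \<phi>"

text \<open>
  Membership of the isomorphism class of \<open>'a\<close> in \<open>U\<^sub>k(n, G)\<close>. All the conditions are invariant
  under isomorphism of \<open>k\<close>-algebras, so they are stated for the representative \<open>'a\<close>.
\<close>

definition in_U_graded :: "nat \<Rightarrow> ('k::field \<Rightarrow> 'a::idom) \<Rightarrow> bool" where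
  "in_U_graded n \<phi> \<longleftrightarrow>
     structure_map \<phi> \<and> ufd TYPE('a) \<and> tr_deg \<phi> = enat n \<and> (\<exists>G. positive_Z_grading \<phi> G)"

end

theory Submission
  imports Defs "HOL-Computational_Algebra.Polynomial"
begin

text \<open>
  If \<open>A\<^sup>[\<^sup>m\<^sup>]\<close> is isomorphic to \<open>B = k\<^sup>[\<^sup>n\<^sup>+\<^sup>m\<^sup>]\<close>, then \<open>A\<close> is a retract of \<open>B\<close>, and after a translation
  the irrelevant ideal \<open>M\<close> of the grading corresponds to the origin. The linear part of the
  image in \<open>B\<close> embeds \<open>M/M\<^sup>2\<close> into the linear forms. Lift a basis of its image to homogeneous
  elements \<open>x\<^sub>1, \<dots>, x\<^sub>r\<close>: they generate \<open>A\<close> by the graded Nakayama lemma, and they are algebraically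
  independent because their images in \<open>B\<close> have linearly independent linear parts. The
  transcendence degree gives \<open>r \<le> n\<close>, and \<open>n + m \<le> r + m\<close> holds since the linear parts of the
  \<open>r + m\<close> generators of \<open>A\<^sup>[\<^sup>m\<^sup>]\<close> span the linear forms of \<open>B\<close>.

  Conversely the grading by degree is positive, and unique factorization passes from \<open>S\<close> to \<open>S[X]\<close>
  by a fraction-free form of the lemma of Gauss.
\<close>

text \<open>The retraction turns cancellation into linear algebra at one point. Let
  \<open>\<iota>\<close> embed A in B and let \<pi> be the retraction. If \<open>\<iota> a\<close>
  has neither constant nor linear term, all its monomials have degree at least two, so \<pi> sends
  it into M^2, and its value is a; this is why linear parts are injective on M/M^2. The argument
  requires \<pi> to carry the variables into M. Since the part of degree 0 is k, the residues of
  their images modulo M are scalars, and the translation subtracts exactly these. Positivity also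
  drives Nakayama: a product of two elements of M receives in degree d only factors of smaller
  degree.

  The two bounds on r have different sources. The transcendence degree is a supremum over
  independent families, so it bounds r from above at once; the lower bound counts linear forms and
  compares no transcendence bases.

  For the converse, the rings k^[n] are subsets of one type, so irreducibility and primality are
  taken relative to a carrier. Where the classical proof passes to the fraction field, scalars are
  distributed over the factors of a product instead.\<close>

abbreviation "lookup \<equiv> Poly_Mapping.lookup"
abbreviation "keys \<equiv> Poly_Mapping.keys"
abbreviation "single \<equiv> Poly_Mapping.single"

section \<open>Monomials, structure maps and coefficients of polynomials\<close>

definition var :: "nat \<Rightarrow> 'r::comm_ring_1 mpoly" where
  "var i = single (single i 1) 1"

definition power_prod :: "(nat \<Rightarrow> 'a::comm_ring_1) \<Rightarrow> (nat \<Rightarrow>\<^sub>0 nat) \<Rightarrow> 'a" where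
  "power_prod x t = (\<Prod>i\<in>keys t. x i ^ lookup t i)"

lemma power_prod_superset:
  assumes "finite S" "keys t \<subseteq> S"
  shows "power_prod x t = (\<Prod>i\<in>S. x i ^ lookup t i)"
  unfolding power_prod_def using assms
  by (intro prod.mono_neutral_left) (auto simp: in_keys_iff)

lemma power_prod_0 [simp]: "power_prod x 0 = 1"
  by (simp add: power_prod_def)

lemma power_prod_add: "power_prod x (s + t) = power_prod x s * power_prod x t"
proof -
  let ?S = "keys s \<union> keys t"
  have "power_prod x (s + t) = (\<Prod>i\<in>?S. x i ^ lookup (s + t) i)"
    by (intro power_prod_superset) (use Poly_Mapping.keys_add[of s t] in auto)
  also have "\<dots> = (\<Prod>i\<in>?S. x i ^ lookup s i) * (\<Prod>i\<in>?S. x i ^ lookup t i)"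
    by (simp add: lookup_add power_add prod.distrib)
  also have "\<dots> = power_prod x s * power_prod x t"
    by (simp add: power_prod_superset[of ?S])
  finally show ?thesis .
qed

lemma power_prod_single [simp]: "power_prod x (single i (Suc 0)) = x i"
  by (simp add: power_prod_def)

lemma structure_map_simps:
  assumes "structure_map \<phi>"
  shows "\<phi> 1 = 1" "\<phi> (c + d) = \<phi> c + \<phi> d" "\<phi> (c * d) = \<phi> c * \<phi> d" "\<phi> 0 = 0"
    "\<phi> (- c) = - \<phi> c" "\<phi> (c - d) = \<phi> c - \<phi> d"
proof -
  show *: "\<phi> 1 = 1" "\<phi> (c + d) = \<phi> c + \<phi> d" "\<phi> (c * d) = \<phi> c * \<phi> d" for c d
    using assms by (auto simp: structure_map_def)
  show z: "\<phi> 0 = 0" using *(2)[of 0 0] by simp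
  show m: "\<phi> (- c) = - \<phi> c" for c using *(2)[of c "- c"] z by (simp add: add_eq_0_iff)
  show "\<phi> (c - d) = \<phi> c - \<phi> d" using *(2)[of c "- d"] m by simp
qed

lemma structure_map_const: "structure_map const_poly"
  by (simp add: structure_map_def const_poly_def mult_single flip: single_add)

lemma structure_map_inj:
  fixes \<phi> :: "'k::field \<Rightarrow> 'a::comm_ring_1"
  assumes "structure_map \<phi>" "\<phi> c = 0"
  shows "c = 0"
proof (rule ccontr)
  assume "c \<noteq> 0"
  then have "\<phi> c * \<phi> (inverse c) = 1"
    using structure_map_simps(1)[OF assms(1)] structure_map_simps(3)[OF assms(1), of c "inverse c"]
    by simp
  then show False using assms(2) by simp
qed

lemma sum_single_lookup: "(\<Sum>t\<in>keys p. single t (lookup p t)) = p"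
  by (rule poly_mapping_eqI)
    (auto simp: lookup_sum lookup_single when_def in_keys_iff sum.delta')

lemma mpoly_induct [case_names single add]:
  fixes p :: "'r::comm_ring_1 mpoly"
  assumes "\<And>t c. P (single t c)" "\<And>p q. P p \<Longrightarrow> P q \<Longrightarrow> P (p + q)"
  shows "P p"
proof -
  have "P (\<Sum>t\<in>S. single t (lookup p t))" if "finite S" for S
    using that assms(1)[of _ 0] by induction (auto intro!: assms)
  from this[of "keys p"] show ?thesis by (simp add: sum_single_lookup)
qed

lemma lookup_const_mult [simp]: "lookup (const_poly c * p) t = c * lookup p t"
  unfolding const_poly_def by (simp flip: mult_map_scale_conv_mult add: Poly_Mapping.map.rep_eq when_def)

lemma lookup_const: "lookup (const_poly c) t = (if t = 0 then c else 0)"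
  by (simp add: const_poly_def lookup_single when_def)

lemma const_poly_simps [simp]: "const_poly 0 = 0" "const_poly 1 = 1"
  "const_poly (c + d) = const_poly c + const_poly d"
  "const_poly (c * d) = const_poly c * const_poly d"
  "const_poly (- c) = - const_poly c"
  by (simp_all add: structure_map_simps[OF structure_map_const])

lemma single_eq_const_mult: "single t c = const_poly c * single t 1"
  by (simp add: const_poly_def mult_single)

subsection \<open>Evaluation\<close>

lemma eval_poly_superset:
  assumes "structure_map \<phi>" "finite S" "keys p \<subseteq> S"
  shows "eval_poly \<phi> x p = (\<Sum>t\<in>S. \<phi> (lookup p t) * power_prod x t)"
  unfolding eval_poly_def power_prod_def[symmetric] using assms
  by (intro sum.mono_neutral_left) (auto simp: in_keys_iff structure_map_simps)

lemma eval_poly_add: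
  assumes "structure_map \<phi>"
  shows "eval_poly \<phi> x (p + q) = eval_poly \<phi> x p + eval_poly \<phi> x q"
proof -
  let ?S = "keys p \<union> keys q"
  show ?thesis
    using Poly_Mapping.keys_add[of p q] assms
    by (simp add: eval_poly_superset[of _ ?S] lookup_add structure_map_simps algebra_simps sum.distrib)
qed

lemma eval_poly_single:
  assumes "structure_map \<phi>"
  shows "eval_poly \<phi> x (single t c) = \<phi> c * power_prod x t"
  using assms by (simp add: eval_poly_superset[of _ "{t}"])

lemma eval_poly_mult:
  assumes "structure_map \<phi>"
  shows "eval_poly \<phi> x (p * q) = eval_poly \<phi> x p * eval_poly \<phi> x q"
proof (induction p rule: mpoly_induct)
  case (single t c)
  show ?case
    by (induction q rule: mpoly_induct)
      (simp_all add: assms mult_single eval_poly_single eval_poly_add power_prod_add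
        structure_map_simps algebra_simps)
qed (simp_all add: algebra_simps eval_poly_add assms)

lemma eval_poly_const [simp]:
  assumes "structure_map \<phi>"
  shows "eval_poly \<phi> x (const_poly c) = \<phi> c"
  using assms by (simp add: const_poly_def eval_poly_single)

lemma eval_poly_var [simp]:
  assumes "structure_map \<phi>"
  shows "eval_poly \<phi> x (var i) = x i"
  using assms by (simp add: var_def eval_poly_single structure_map_simps)

lemma eval_poly_structure:
  assumes "structure_map \<phi>"
  shows "structure_map (eval_poly \<phi> x)"
  using assms eval_poly_const[OF assms, of x 1]
  by (simp add: structure_map_def eval_poly_add eval_poly_mult)

lemma power_prod_var [simp]: "power_prod var t = single t 1"
proof -
  have *: "var i ^ n = single (single i n) (1::'a)" for i n
    by (induction n) (simp_all add: var_def mult_single flip: single_add)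
  have **: "(\<Prod>i\<in>S. single (f i) 1) = single (sum f S) (1::'a)" if "finite S"
    for S :: "nat set" and f :: "nat \<Rightarrow> (nat \<Rightarrow>\<^sub>0 nat)"
    using that by induction (simp_all add: mult_single)
  show ?thesis
    by (simp add: power_prod_def * ** sum_single_lookup)
qed

subsection \<open>Polynomial subrings\<close>

lemma poly_ring_const [simp, intro]: "const_poly c \<in> poly_ring m"
  by (simp add: poly_ring_def const_poly_def)

lemma poly_ring_01 [simp, intro]: "0 \<in> poly_ring m" "1 \<in> poly_ring m"
  using poly_ring_const[of 0 m] poly_ring_const[of 1 m] by simp_all

lemma poly_ring_var [simp]: "i < m \<Longrightarrow> var i \<in> poly_ring m"
  by (simp add: poly_ring_def var_def)

lemma poly_ring_add [intro]: "p \<in> poly_ring m \<Longrightarrow> q \<in> poly_ring m \<Longrightarrow> p + q \<in> poly_ring m"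
  using Poly_Mapping.keys_add[of p q] unfolding poly_ring_def by blast

lemma poly_ring_mult [intro]:
  assumes "p \<in> poly_ring m" "q \<in> poly_ring m"
  shows "p * q \<in> poly_ring m"
  unfolding poly_ring_def
proof (intro CollectI ballI)
  fix t assume "t \<in> keys (p * q)"
  then obtain a b where "t = a + b" "a \<in> keys p" "b \<in> keys q"
    using Poly_Mapping.keys_mult[of p q] by blast
  then show "keys t \<subseteq> {..<m}"
    using assms Poly_Mapping.keys_add[of a b] unfolding poly_ring_def by blast
qed

lemma poly_ring_uminus [intro]: "p \<in> poly_ring m \<Longrightarrow> - p \<in> poly_ring m"
  using poly_ring_mult[OF poly_ring_const[of "- 1"], of p m] by simp

lemma poly_ring_diff [intro]: "p \<in> poly_ring m \<Longrightarrow> q \<in> poly_ring m \<Longrightarrow> p - q \<in> poly_ring m"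
  using poly_ring_add[of p m "- q"] by auto

lemma poly_ring_sum [intro]: "(\<And>i. i \<in> S \<Longrightarrow> f i \<in> poly_ring m) \<Longrightarrow> sum f S \<in> poly_ring m"
  by (induction S rule: infinite_finite_induct) auto

lemma poly_ring_mono: "m \<le> n \<Longrightarrow> p \<in> poly_ring m \<Longrightarrow> p \<in> poly_ring n"
  by (fastforce simp: poly_ring_def)

text \<open>The subring is generated by constants and variables. The cases for sums and products
  also supply membership of \<open>p\<close> and \<open>q\<close>, because the maps studied later
  are homomorphisms only on the subring.\<close>

lemma poly_ring_induct [consumes 1, case_names const var add mult]:
  assumes "p \<in> poly_ring m"
    and const: "\<And>c. P (const_poly c)"
    and var: "\<And>i. i < m \<Longrightarrow> P (var i)"
    and add: "\<And>p q. p \<in> poly_ring m \<Longrightarrow> q \<in> poly_ring m \<Longrightarrow> P p \<Longrightarrow> P q \<Longrightarrow> P (p + q)"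
    and mult: "\<And>p q. p \<in> poly_ring m \<Longrightarrow> q \<in> poly_ring m \<Longrightarrow> P p \<Longrightarrow> P q \<Longrightarrow> P (p * q)"
  shows "P p"
proof -
  define Q where "Q p \<longleftrightarrow> p \<in> poly_ring m \<and> P p" for p
  have c: "Q (const_poly c)" for c by (simp add: Q_def const)
  have Q0: "Q 0" "Q 1" using c[of 0] c[of 1] by simp_all
  have Qm: "Q p \<Longrightarrow> Q q \<Longrightarrow> Q (p * q)" and Qa: "Q p \<Longrightarrow> Q q \<Longrightarrow> Q (p + q)" for p q
    by (auto simp: Q_def add mult)
  have pow: "Q (var i ^ n)" if "i < m" for i n
    using that by (induction n) (auto intro!: Qm Q0 simp: Q_def[of "var i"] var)
  have "Q (prod f S)" if "finite S" "\<And>i. i \<in> S \<Longrightarrow> Q (f i)" for f :: "nat \<Rightarrow> _" and S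
    using that by induction (auto intro: Q0 Qm)
  note prod = this
  have "Q (power_prod var t)" if "keys t \<subseteq> {..<m}" for t
    unfolding power_prod_def using that by (intro prod pow) auto
  then have s: "Q (single t c)" if "keys t \<subseteq> {..<m}" for t c
    using that by (subst single_eq_const_mult) (auto intro!: Qm c)
  have "Q (sum f S)" if "finite S" "\<And>i. i \<in> S \<Longrightarrow> Q (f i)" for f :: "(nat \<Rightarrow>\<^sub>0 nat) \<Rightarrow> _" and S
    using that by induction (auto intro: Q0 Qa)
  then have "Q (\<Sum>t\<in>keys p. single t (lookup p t))"
    using assms(1) s by (auto simp: poly_ring_def)
  then show ?thesis by (simp add: sum_single_lookup Q_def)
qed

lemma eval_poly_in_subalgebra:
  assumes \<phi>: "structure_map \<phi>" and "p \<in> poly_ring m"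
    and "\<And>c. \<phi> c \<in> S" "\<And>i. i < m \<Longrightarrow> x i \<in> S"
    and "\<And>a b. a \<in> S \<Longrightarrow> b \<in> S \<Longrightarrow> a + b \<in> S" "\<And>a b. a \<in> S \<Longrightarrow> b \<in> S \<Longrightarrow> a * b \<in> S"
  shows "eval_poly \<phi> x p \<in> S"
  using assms(2) by (induction p rule: poly_ring_induct)
    (auto simp: assms eval_poly_add[OF \<phi>] eval_poly_mult[OF \<phi>])

text \<open>The universal property, for a map that is known to respect the operations only on the
  subring; elsewhere \<open>h\<close> is arbitrary.\<close>

lemma poly_ring_hom_eq_eval_poly:
  assumes \<phi>: "structure_map \<phi>" and p: "p \<in> poly_ring m"
    and "\<And>p q. p \<in> poly_ring m \<Longrightarrow> q \<in> poly_ring m \<Longrightarrow> h (p + q) = h p + h q"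
    and "\<And>p q. p \<in> poly_ring m \<Longrightarrow> q \<in> poly_ring m \<Longrightarrow> h (p * q) = h p * h q"
    and "\<And>c. h (const_poly c) = \<phi> c"
  shows "h p = eval_poly \<phi> (\<lambda>i. h (var i)) p"
  using p by (induction p rule: poly_ring_induct)
    (auto simp: assms eval_poly_add[OF \<phi>] eval_poly_mult[OF \<phi>])

lemma eval_poly_comp:
  assumes \<phi>: "structure_map \<phi>" and \<psi>: "structure_map \<psi>" and h: "structure_map h"
    and c: "\<And>c. h (\<phi> c) = \<psi> c" and p: "p \<in> poly_ring m"
  shows "h (eval_poly \<phi> x p) = eval_poly \<psi> (\<lambda>i. h (x i)) p"
  using p by (induction p rule: poly_ring_induct)
    (auto simp: \<phi> \<psi> h c eval_poly_add eval_poly_mult structure_map_simps(2,3)[OF h])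

lemma poly_ring_exists: "\<exists>m. p \<in> poly_ring m"
proof -
  have "finite (\<Union>t\<in>keys p. keys t)" by simp
  then obtain m where "(\<Union>t\<in>keys p. keys t) \<subseteq> {..<m}"
    by (meson finite_nat_iff_bounded)
  then show ?thesis by (auto simp: poly_ring_def)
qed

subsection \<open>Homogeneous components\<close>

definition mdeg :: "(nat \<Rightarrow>\<^sub>0 nat) \<Rightarrow> nat" where
  "mdeg t = (\<Sum>i\<in>keys t. lookup t i)"

lemma mdeg_add: "mdeg (s + t) = mdeg s + mdeg t"
proof -
  have *: "mdeg u = (\<Sum>i\<in>keys s \<union> keys t. lookup u i)" if "keys u \<subseteq> keys s \<union> keys t" for u
    unfolding mdeg_def using that by (intro sum.mono_neutral_left) (auto simp: in_keys_iff)
  show ?thesis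
    using Poly_Mapping.keys_add[of s t] by (simp add: * lookup_add sum.distrib)
qed

lemma mdeg_single [simp]: "mdeg (single i n) = n"
  by (simp add: mdeg_def)

lemma mdeg_eq_0_iff [simp]: "mdeg t = 0 \<longleftrightarrow> t = 0"
proof
  assume "mdeg t = 0"
  then show "t = 0" by (auto simp: mdeg_def in_keys_iff intro!: poly_mapping_eqI)
qed (simp add: mdeg_def)

lemma mdeg_0 [simp]: "mdeg 0 = 0"
  by simp

lemma single_Suc_0_neq_0 [simp]: "single (i::nat) (Suc 0) \<noteq> 0"
  using mdeg_single[of i "Suc 0"] by (metis mdeg_0 Zero_neq_Suc)

lemma decompose_power:
  assumes "(t::nat \<Rightarrow>\<^sub>0 nat) \<noteq> 0"
  obtains s i where "t = s + single i 1" "i \<in> keys t"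
proof -
  obtain i where i: "i \<in> keys t" using assms by fastforce
  have "t = (t - single i 1) + single i 1"
    using i by (intro poly_mapping_eqI) (auto simp: lookup_add lookup_minus lookup_single when_def in_keys_iff)
  with i show thesis using that by blast
qed

definition hom_part :: "nat \<Rightarrow> 'r::comm_ring_1 mpoly \<Rightarrow> 'r mpoly" where
  "hom_part d p = (\<Sum>t\<in>{t\<in>keys p. mdeg t = d}. single t (lookup p t))"

lemma lookup_hom_part: "lookup (hom_part d p) t = (if mdeg t = d then lookup p t else 0)"
proof -
  have "lookup (hom_part d p) t = (\<Sum>s\<in>{t\<in>keys p. mdeg t = d}. lookup p s when s = t)"
    by (simp add: hom_part_def lookup_sum lookup_single)
  also have "\<dots> = (if mdeg t = d then lookup p t else 0)"
    by (simp add: when_def in_keys_iff)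
  finally show ?thesis .
qed

lemma hom_part_add: "hom_part d (p + q) = hom_part d p + hom_part d q"
  by (rule poly_mapping_eqI) (simp add: lookup_hom_part lookup_add)

lemma hom_part_diff: "hom_part d (p - q) = hom_part d p - hom_part d q"
  by (rule poly_mapping_eqI) (simp add: lookup_hom_part lookup_minus)

lemma hom_part_0 [simp]: "hom_part d 0 = 0"
  by (rule poly_mapping_eqI) (simp add: lookup_hom_part)

lemma hom_part_const_mult: "hom_part d (const_poly c * p) = const_poly c * hom_part d p"
  by (rule poly_mapping_eqI) (simp add: lookup_hom_part)

lemma hom_part_idem [simp]: "hom_part d (hom_part d p) = hom_part d p"
  by (rule poly_mapping_eqI) (simp add: lookup_hom_part)

lemma hom_part_single: "hom_part d (single t c) = (if mdeg t = d then single t c else 0)"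
  by (rule poly_mapping_eqI) (auto simp: lookup_hom_part lookup_single when_def)

lemma hom_part_var [simp]: "hom_part 1 (var i) = var i"
  by (simp add: var_def hom_part_single)

lemma hom_part_1_const [simp]: "hom_part 1 (const_poly c) = 0"
  by (simp add: const_poly_def hom_part_single mdeg_def)

lemma hom_part_poly_ring: "p \<in> poly_ring m \<Longrightarrow> hom_part d p \<in> poly_ring m"
  by (auto simp: poly_ring_def in_keys_iff lookup_hom_part split: if_splits)

text \<open>The monomial 1 is a product of two monomials only as 1 times 1.\<close>

lemma lookup_mult_0: "lookup (p * q) 0 = lookup p 0 * lookup (q :: 'r::comm_ring_1 mpoly) 0"
proof (induction p rule: mpoly_induct)
  case (single t c)
  have *: "a + b = 0 \<longleftrightarrow> a = 0 \<and> b = 0" for a b :: "nat \<Rightarrow>\<^sub>0 nat"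
    using mdeg_add[of a b] by (metis add_is_0 mdeg_eq_0_iff)
  show ?case
    by (induction q rule: mpoly_induct)
      (auto simp: mult_single lookup_single when_def algebra_simps lookup_add *)
qed (simp add: algebra_simps lookup_add)

text \<open>The Leibniz rule at the origin. A monomial of degree one factors only as itself times 1,
  so each factor contributes its linear part scaled by the constant term of the other.\<close>

lemma hom_part_1_mult:
  "hom_part 1 (p * q) = const_poly (lookup p 0) * hom_part 1 q + const_poly (lookup q 0) * hom_part 1 p"
proof (induction p rule: mpoly_induct)
  case (single t c)
  show ?case
  proof (induction q rule: mpoly_induct)
    case (single s d)
    have "mdeg (t + s) = 1 \<longleftrightarrow> mdeg t = 1 \<and> s = 0 \<or> mdeg s = 1 \<and> t = 0"
      by (auto simp: mdeg_add add_is_1)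
    then show ?case
      by (auto simp: mult_single hom_part_single const_poly_def lookup_single when_def mult.commute add.commute)
  qed (simp add: algebra_simps hom_part_add lookup_add)
qed (simp add: algebra_simps hom_part_add lookup_add)

lemma hom_part_1_eq_sum:
  assumes "p \<in> poly_ring m"
  shows "hom_part 1 p = (\<Sum>i<m. const_poly (lookup p (single i 1)) * var i)"
  using assms
proof (induction p rule: poly_ring_induct)
  case (const c)
  show ?case using hom_part_1_const[of c] by (simp add: lookup_const del: hom_part_1_const)
next
  case (var i)
  have *: "single i 1 = single j (1::nat) \<longleftrightarrow> i = j" for j :: nat
    by (metis (no_types) lookup_single_eq lookup_single_not_eq zero_neq_one)
  have "const_poly (lookup (var i) (single j 1)) * var j = (if i = j then var i else (0 :: 'a mpoly))" for j
    using * by (simp add: var_def lookup_single when_def)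
  then have "(\<Sum>j<m. const_poly (lookup (var i) (single j 1)) * var j) = (var i :: 'a mpoly)"
    using var by (subst sum.cong[OF refl]) (auto simp: sum.delta)
  then show ?case by (simp only: hom_part_var)
next
  case (add p q)
  then show ?case by (simp add: hom_part_add lookup_add algebra_simps sum.distrib)
next
  case (mult p q)
  have "lookup (p * q) (single i 1) = lookup p 0 * lookup q (single i 1) + lookup q 0 * lookup p (single i 1)" for i
    using arg_cong[OF hom_part_1_mult[of p q], of "\<lambda>r. lookup r (single i 1)"]
    by (simp add: lookup_add lookup_hom_part)
  then show ?case
    unfolding hom_part_1_mult mult.hyps mult.IH
    by (simp add: algebra_simps sum.distrib sum_distrib_left)
qed

subsection \<open>Positive gradings\<close>

locale positively_graded =
  fixes \<phi> :: "'k::field \<Rightarrow> 'a::idom" and G :: "int \<Rightarrow> 'a set"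
  assumes \<phi>_structure: "structure_map \<phi>" and grading: "positive_Z_grading \<phi> G"
begin

lemmas \<phi>_simps = structure_map_simps[OF \<phi>_structure]

lemma G_0 [simp]: "0 \<in> G i"
  and G_diff: "a \<in> G i \<Longrightarrow> b \<in> G i \<Longrightarrow> a - b \<in> G i"
  and G_mult: "a \<in> G i \<Longrightarrow> c \<in> G j \<Longrightarrow> a * c \<in> G (i + j)"
  and G_neg: "i < 0 \<Longrightarrow> G i = {0}"
  and G_0_eq: "G 0 = range \<phi>"
  using grading by (auto simp: positive_Z_grading_def Z_grading_def)

lemma G_add: "a \<in> G i \<Longrightarrow> b \<in> G i \<Longrightarrow> a + b \<in> G i"
  using G_diff[of a i "0 - b"] G_diff[of 0 i b] by simp

definition decomp :: "'a \<Rightarrow> int \<Rightarrow>\<^sub>0 'a" where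
  "decomp a = (THE h. (\<forall>i. lookup h i \<in> G i) \<and> a = (\<Sum>i\<in>keys h. lookup h i))"

abbreviation comp :: "int \<Rightarrow> 'a \<Rightarrow> 'a" where
  "comp i a \<equiv> lookup (decomp a) i"

lemma decomp_ex1: "\<exists>!h. (\<forall>i. lookup h i \<in> G i) \<and> a = (\<Sum>i\<in>keys h. lookup h i)"
  using grading unfolding positive_Z_grading_def Z_grading_def by (elim conjE) (erule spec)

lemma decomp_spec: "(\<forall>i. comp i a \<in> G i) \<and> a = (\<Sum>i\<in>keys (decomp a). comp i a)"
  using theI'[OF decomp_ex1[of a]] by (fold decomp_def)

lemma comp_mem [simp]: "comp i a \<in> G i"
  using decomp_spec by blast

lemma sum_comp: "(\<Sum>i\<in>keys (decomp a). comp i a) = a"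
  using decomp_spec by (rule conjunct2[THEN sym])

lemma decomp_eqI:
  assumes "\<And>i. lookup h i \<in> G i" "a = (\<Sum>i\<in>keys h. lookup h i)"
  shows "decomp a = h"
  unfolding decomp_def by (rule the1_equality[OF decomp_ex1]) (use assms in auto)

lemma decomp_add: "decomp (a + b) = decomp a + decomp b"
proof (rule decomp_eqI)
  fix i show "lookup (decomp a + decomp b) i \<in> G i"
    by (simp add: lookup_add G_add)
next
  let ?S = "keys (decomp a) \<union> keys (decomp b)"
  have *: "(\<Sum>i\<in>keys h. lookup h i) = (\<Sum>i\<in>?S. lookup h i)" if "keys h \<subseteq> ?S" for h
    using that by (intro sum.mono_neutral_left) (auto simp: in_keys_iff)
  have "(\<Sum>i\<in>keys (decomp a + decomp b). lookup (decomp a + decomp b) i) =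
      (\<Sum>i\<in>?S. lookup (decomp a + decomp b) i)"
    using Poly_Mapping.keys_add by (intro *)
  also have "\<dots> = (\<Sum>i\<in>keys (decomp a). comp i a) + (\<Sum>i\<in>keys (decomp b). comp i b)"
    by (simp add: lookup_add sum.distrib *)
  finally show "a + b = (\<Sum>i\<in>keys (decomp a + decomp b). lookup (decomp a + decomp b) i)"
    by (simp add: sum_comp)
qed

lemma comp_add: "comp i (a + b) = comp i a + comp i b"
  by (simp add: decomp_add lookup_add)

lemma comp_homogeneous: "a \<in> G j \<Longrightarrow> comp i a = (if i = j then a else 0)"
  by (subst decomp_eqI[of "single j a"]) (auto simp: lookup_single when_def)

lemma comp_zero [simp]: "comp i 0 = 0"
  using comp_homogeneous[of 0] by simp

lemma comp_sum: "comp i (sum f S) = (\<Sum>j\<in>S. comp i (f j))"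
  by (induction S rule: infinite_finite_induct) (simp_all add: comp_add)

lemma comp_neg: "i < 0 \<Longrightarrow> comp i a = 0"
  using comp_mem[of a i] G_neg by simp

lemma \<phi>_mem: "\<phi> c \<in> G 0"
  by (simp add: G_0_eq)

lemma comp_scale: "comp i (\<phi> c * a) = \<phi> c * comp i a"
proof -
  have "\<phi> c * comp j a \<in> G j" for j
    using G_mult[OF \<phi>_mem[of c] comp_mem[of a j]] by simp
  then have *: "comp i (\<phi> c * comp j a) = (if i = j then \<phi> c * comp j a else 0)" for j
    by (rule comp_homogeneous)
  have "comp i (\<phi> c * a) = comp i (\<Sum>j\<in>keys (decomp a). \<phi> c * comp j a)"
    by (simp add: sum_comp flip: sum_distrib_left)
  also have "\<dots> = \<phi> c * comp i a"
    by (simp add: comp_sum * in_keys_iff)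
  finally show ?thesis .
qed

text \<open>Components of negative index vanish, so this is the sum of the \<open>G i\<close> with i
  > 0, the ideal M of the overview.\<close>

definition irrelevant :: "'a set" where
  "irrelevant = {a. comp 0 a = 0}"

lemma irrelevant_0 [simp]: "0 \<in> irrelevant"
  and irrelevant_add: "a \<in> irrelevant \<Longrightarrow> b \<in> irrelevant \<Longrightarrow> a + b \<in> irrelevant"
  by (simp_all add: irrelevant_def comp_add)

lemma irrelevant_homogeneous: "a \<in> G i \<Longrightarrow> i > 0 \<Longrightarrow> a \<in> irrelevant"
  by (simp add: irrelevant_def comp_homogeneous)

lemma irrelevant_induct [consumes 1, case_names zero homogeneous add]:
  assumes a: "a \<in> irrelevant" and "P 0" "\<And>i a. i > 0 \<Longrightarrow> a \<in> G i \<Longrightarrow> P a"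
    and "\<And>a b. P a \<Longrightarrow> P b \<Longrightarrow> P (a + b)"
  shows "P a"
proof -
  have "P (comp i a)" for i
    using assms comp_mem[of a i] comp_neg[of i a] by (cases i "0::int" rule: linorder_cases)
      (auto simp: irrelevant_def)
  then have "P (\<Sum>i\<in>S. comp i a)" for S
    using assms by (induction S rule: infinite_finite_induct) auto
  then show ?thesis using sum_comp[of a] by metis
qed

lemma irrelevant_mult:
  assumes "a \<in> irrelevant"
  shows "b * a \<in> irrelevant"
proof -
  have *: "comp i b * a \<in> irrelevant" for i
    using assms
  proof (induction a rule: irrelevant_induct)
    case (homogeneous j a)
    show ?case
    proof (cases "i < 0")
      case False
      then show ?thesis
        using homogeneous by (intro irrelevant_homogeneous[OF G_mult[OF comp_mem]]) auto
    qed (simp add: comp_neg)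
  qed (auto simp: algebra_simps irrelevant_add)
  have "(\<Sum>i\<in>S. comp i b * a) \<in> irrelevant" for S
    using * by (induction S rule: infinite_finite_induct) (auto simp: irrelevant_add)
  then show ?thesis
    unfolding sum_distrib_right[symmetric] using sum_comp[of b] by metis
qed

lemma \<phi>_irrelevant: "\<phi> c \<in> irrelevant \<longleftrightarrow> c = 0"
  using structure_map_inj[OF \<phi>_structure, of c]
  by (auto simp: irrelevant_def comp_homogeneous[OF \<phi>_mem] \<phi>_simps(4))

text \<open>The residue field of the irrelevant ideal is k, because \<open>G 0\<close> is the range
  of \<open>\<phi>\<close>. The scalar found here becomes a coordinate of the point that is
  translated to the origin.\<close>

lemma ex_scalar_part: "\<exists>c. a - \<phi> c \<in> irrelevant"
proof -
  obtain c where c: "comp 0 a = \<phi> c"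
    using comp_mem[of a 0] G_0_eq by auto
  have "comp 0 a = comp 0 (a - \<phi> c) + comp 0 (\<phi> c)"
    by (simp flip: comp_add)
  then show ?thesis
    by (auto simp: irrelevant_def c comp_homogeneous[OF \<phi>_mem] intro!: exI[of _ c])
qed

text \<open>The square of the ideal as finite sums of products, built one product at a time so that
  its elements can be treated by induction.\<close>

inductive_set irrelevant_square :: "'a set" where
  zero: "0 \<in> irrelevant_square"
| add_mult: "s \<in> irrelevant_square \<Longrightarrow> a \<in> irrelevant \<Longrightarrow> b \<in> irrelevant \<Longrightarrow>
    a * b + s \<in> irrelevant_square"

lemma irrelevant_square_mult:
  "a \<in> irrelevant \<Longrightarrow> b \<in> irrelevant \<Longrightarrow> a * b \<in> irrelevant_square"
  using irrelevant_square.add_mult[OF irrelevant_square.zero] by simp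

lemma irrelevant_square_add:
  "a \<in> irrelevant_square \<Longrightarrow> b \<in> irrelevant_square \<Longrightarrow> a + b \<in> irrelevant_square"
  by (induction a rule: irrelevant_square.induct)
    (auto simp: add.assoc intro: irrelevant_square.intros)

text \<open>Induction on the degree. The hypothesis \<open>gen\<close> says that \<open>C\<close>
  exhausts each positive degree modulo the square of the irrelevant ideal, and the component of
  degree d of an element of that square is a sum of products of homogeneous elements of positive
  degree below d, which are in \<open>C\<close> already. Since only a component of
  \<open>a - s\<close> is asked for, \<open>s\<close> may be inhomogeneous.\<close>

lemma graded_nakayama:
  assumes C: "\<And>c. \<phi> c \<in> C" "\<And>a b. a \<in> C \<Longrightarrow> b \<in> C \<Longrightarrow> a + b \<in> C"
      "\<And>a b. a \<in> C \<Longrightarrow> b \<in> C \<Longrightarrow> a * b \<in> C"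
    and gen: "\<And>d a. d > 0 \<Longrightarrow> a \<in> G d \<Longrightarrow>
      \<exists>s\<in>irrelevant_square. comp d (a - s) \<in> C"
  shows "a \<in> C"
proof -
  have C0: "0 \<in> C" using C(1)[of 0] by (simp add: \<phi>_simps)
  have "G (int d) \<subseteq> C" for d
  proof (induction d rule: less_induct)
    case (less d)
    show ?case
    proof (cases "d = 0")
      case True
      then show ?thesis using C(1) by (auto simp: G_0_eq)
    next
      case False
      have prod: "comp d (u * v) \<in> C" if "u \<in> irrelevant" "v \<in> irrelevant" for u v
        using that(1)
      proof (induction u rule: irrelevant_induct)
        case (homogeneous i u)
        note u = this
        show ?case using that(2)
        proof (induction v rule: irrelevant_induct)
          case (homogeneous j v)
          \<comment> \<open>Both i and j are positive, so both are smaller than d and the induction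
            hypothesis applies to each factor.\<close>
          have "u * v \<in> C" if "int d = i + j"
          proof -
            have "u \<in> G (int (nat i))" "v \<in> G (int (nat j))" "nat i < d" "nat j < d"
              using u homogeneous that by auto
            then show ?thesis using less C(3) by blast
          qed
          then show ?case
            by (simp add: comp_homogeneous[OF G_mult[OF u(2) homogeneous(2)]] C0)
        qed (simp_all add: C0 C(2) distrib_left comp_add)
      qed (simp_all add: C0 C(2) distrib_right comp_add)
      have sq: "comp d s \<in> C" if "s \<in> irrelevant_square" for s
        using that by induction (simp_all add: C0 comp_add C(2) prod)
      show ?thesis
      proof
        fix a assume a: "a \<in> G (int d)"
        obtain s where s: "s \<in> irrelevant_square" "comp d (a - s) \<in> C"
          using gen[OF _ a] False by auto
        have "comp d a = comp d (a - s) + comp d s"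
          by (simp flip: comp_add)
        then show "a \<in> C"
          using a C(2)[OF s(2) sq[OF s(1)]] by (simp add: comp_homogeneous)
      qed
    qed
  qed
  then have "comp i a \<in> C" for i
  proof (cases "i < 0")
    case False
    then have "comp i a \<in> G (int (nat i))" by simp
    then show ?thesis using \<open>\<And>d. G (int d) \<subseteq> C\<close> by blast
  qed (simp add: comp_neg C0)
  then have "(\<Sum>i\<in>S. comp i a) \<in> C" for S
    by (induction S rule: infinite_finite_induct) (auto simp: C0 C(2))
  then show ?thesis using sum_comp[of a] by metis
qed

end

subsection \<open>Linear parts and independence\<close>

text \<open>Scalars act through constant polynomials. This makes bases, spans, exchange and
  extension of linear maps available for linear forms.\<close>

global_interpretation mpoly: vector_space "\<lambda>c (p :: 'k::field mpoly). const_poly c * p"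
  by standard (simp_all add: algebra_simps)

global_interpretation mpoly: vector_space_pair
  "\<lambda>c (p :: 'k::field mpoly). const_poly c * p" "\<lambda>c (p :: 'k mpoly). const_poly c * p" ..

lemma inj_var: "inj (var :: nat \<Rightarrow> 'k::field mpoly)"
proof (rule injI)
  fix i j assume "var i = (var j :: 'k mpoly)"
  then have "lookup (var i :: 'k mpoly) (single i 1) = lookup (var j :: 'k mpoly) (single i 1)"
    by simp
  then have "single i (1::nat) = single j 1"
    by (simp add: var_def lookup_single when_def split: if_splits)
  then show "i = j"
    by (metis lookup_single_eq lookup_single_not_eq zero_neq_one)
qed

lemma single_1_eq_iff: "single i (Suc 0) = single j (Suc 0) \<longleftrightarrow> i = j"
  by (metis lookup_single_eq lookup_single_not_eq Zero_neq_Suc)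

lemma independent_vars: "mpoly.independent (var ` S :: 'k::field mpoly set)"
proof -
  have "\<not> mpoly.dependent (var ` S :: 'k mpoly set)" if fin: "finite S" for S
  proof (subst mpoly.dependent_finite)
    show "finite (var ` S :: 'k mpoly set)" using fin by simp
    have "u (var i) = 0" if "(\<Sum>v\<in>var ` S. const_poly (u v) * v) = (0 :: 'k mpoly)" "i \<in> S" for u i
    proof -
      have "lookup (\<Sum>j\<in>S. const_poly (u (var j)) * var j) (single i 1) = (0 :: 'k)"
        using that(1) by (subst (asm) sum.reindex) (auto intro: inj_on_subset[OF inj_var])
      then show ?thesis
        using fin that(2)
        by (simp add: lookup_sum var_def lookup_single when_def single_1_eq_iff sum.delta if_distrib
            cong: if_cong)
    qed
    then show "\<not> (\<exists>u. (\<exists>v\<in>var ` S. u v \<noteq> 0) \<and>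
        (\<Sum>v\<in>var ` S. const_poly (u v) * v) = (0 :: 'k mpoly))"
      by blast
  qed
  note fin = this
  show ?thesis
  proof
    assume "mpoly.dependent (var ` S :: 'k mpoly set)"
    then obtain T where "finite T" "T \<subseteq> (var ` S :: 'k mpoly set)" "mpoly.dependent T"
      unfolding mpoly.dependent_explicit[of "var ` S"] mpoly.dependent_explicit by blast
    then show False
      using fin by (metis finite_subset_image)
  qed
qed

lemma hom_part_1_span:
  "p \<in> poly_ring m \<Longrightarrow> hom_part 1 p \<in> mpoly.span (var ` {..<m} :: 'k::field mpoly set)"
  by (subst hom_part_1_eq_sum, assumption)
    (intro mpoly.span_sum mpoly.span_scale mpoly.span_base, simp)

text \<open>Orders of vanishing at the origin add under multiplication.\<close>

lemma lookup_mult_low: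
  fixes p q :: "'k::comm_ring_1 mpoly"
  assumes "\<And>s. mdeg s < a \<Longrightarrow> lookup p s = 0" "\<And>s. mdeg s < b \<Longrightarrow> lookup q s = 0"
    and "mdeg s < a + b"
  shows "lookup (p * q) s = 0"
proof (rule ccontr)
  assume "lookup (p * q) s \<noteq> 0"
  then obtain u v where "s = u + v" "lookup p u \<noteq> 0" "lookup q v \<noteq> 0"
    using Poly_Mapping.keys_mult[of p q] by (auto simp: in_keys_iff subset_iff)
  moreover from this have "a \<le> mdeg u" "b \<le> mdeg v"
    using assms(1,2) by (meson not_less)+
  ultimately show False using assms(3) by (simp add: mdeg_add)
qed

text \<open>Each \<open>y i\<close> differs from its variable only in degree two and above, and
  replacing the variables of a monomial one at a time by the \<open>y i\<close> creates errors only
  in degrees above that of the monomial.\<close>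

lemma tangent_to_identity_power_prod:
  fixes y :: "nat \<Rightarrow> 'k::comm_ring_1 mpoly"
  assumes y: "\<And>i. i < n \<Longrightarrow> lookup (y i) 0 = 0" "\<And>i. i < n \<Longrightarrow> hom_part 1 (y i) = var i"
    and "keys t \<subseteq> {..<n}" "mdeg s \<le> mdeg t"
  shows "lookup (power_prod y t) s = (if s = t then 1 else 0)"
proof -
  have "lookup (power_prod y t - single t 1) s = 0" if "mdeg s < mdeg t + 1" for s
    using assms(3) that
  proof (induction "mdeg t" arbitrary: t s)
    case 0
    then show ?case by simp
  next
    case (Suc d)
    then have "t \<noteq> 0" by auto
    then obtain u i where ui: "t = u + single i 1" "i \<in> keys t"
      by (rule decompose_power)
    have d: "d = mdeg u" using Suc.hyps(2) ui(1) by (simp add: mdeg_add)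
    have "lookup u j \<noteq> 0 \<Longrightarrow> lookup t j \<noteq> 0" for j
      by (simp add: ui(1) lookup_add)
    then have u: "keys u \<subseteq> {..<n}" using Suc.prems(1) by (auto simp: subset_iff in_keys_iff)
    have i: "i < n" using ui(2) Suc.prems(1) by auto
    \<comment> \<open>Exchange the factors one at a time. The first summand vanishes to order
      (\<open>mdeg u\<close> + 1) + 1 and the second to order \<open>mdeg u\<close> + 2, both above
      \<open>mdeg t\<close> = \<open>mdeg u\<close> + 1.\<close>
    have eq: "power_prod y t - single t 1 =
        (power_prod y u - single u 1) * y i + single u 1 * (y i - var i)"
      using ui(1) by (simp add: power_prod_add algebra_simps var_def mult_single)
    have low: "lookup (y i - var i) r = 0" if "mdeg r < 2" for r
    proof (cases "r = 0")
      case True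
      show ?thesis using y(1)[OF i] True by (simp add: lookup_minus var_def lookup_single)
    next
      case False
      then have "mdeg r = 1" using that mdeg_eq_0_iff[of r] by linarith
      then have "lookup (hom_part 1 (y i)) r = lookup (y i) r"
        by (simp add: lookup_hom_part)
      then show ?thesis by (simp only: lookup_minus y(2)[OF i]) simp
    qed
    have "lookup ((power_prod y u - single u 1) * y i) s = 0"
      using Suc.hyps(1)[OF d u] Suc.prems(2) y(1)[OF i] d Suc.hyps(2)
      by (intro lookup_mult_low[of "mdeg u + 1" _ 1]) auto
    moreover have "lookup (single u 1 * (y i - var i)) s = 0"
      using low Suc.prems(2) d Suc.hyps(2)
      by (intro lookup_mult_low[of "mdeg u" _ 2]) (auto simp: lookup_single when_def)
    ultimately show ?case by (simp add: eq lookup_add)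
  qed
  from this[of s] assms(4) show ?thesis
    by (auto simp: lookup_minus lookup_single when_def)
qed

text \<open>A monomial t of least degree in p survives the substitution: another monomial of p has
  at least the same degree, so its image has coefficient 0 at t.\<close>

lemma tangent_to_identity_inj:
  fixes y :: "nat \<Rightarrow> 'k::comm_ring_1 mpoly"
  assumes y: "\<And>i. i < n \<Longrightarrow> lookup (y i) 0 = 0" "\<And>i. i < n \<Longrightarrow> hom_part 1 (y i) = var i"
    and p: "p \<in> poly_ring n" "eval_poly const_poly y p = 0"
  shows "p = 0"
proof (rule ccontr)
  assume "p \<noteq> 0"
  then have "keys p \<noteq> {}" by simp
  then obtain t where t: "t \<in> keys p" "\<And>s. s \<in> keys p \<Longrightarrow> mdeg t \<le> mdeg s"
    using ex_min_if_finite[of "mdeg ` keys p"] by (auto simp: not_less)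
  have "lookup (power_prod y s) t = (if t = s then 1 else 0)" if "s \<in> keys p" for s
    using that p(1) t(2)[OF that] y
    by (intro tangent_to_identity_power_prod[of n]) (auto simp: poly_ring_def)
  then have "lookup (eval_poly const_poly y p) t = (\<Sum>s\<in>keys p. if t = s then lookup p s else 0)"
    unfolding eval_poly_def power_prod_def[symmetric] lookup_sum
    by (intro sum.cong) auto
  also have "\<dots> = lookup p t" using t(1) by simp
  finally show False using p(2) t(1) by (simp add: in_keys_iff)
qed

text \<open>Composing with an endomorphism that maps the linear part of \<open>y i\<close> to the \<open>i\<close>-th variable makes
  the family tangent to the identity.\<close>

lemma independent_linear_parts_imp_inj:
  fixes y :: "nat \<Rightarrow> 'k::field mpoly"
  assumes y0: "\<And>i. i < n \<Longrightarrow> lookup (y i) 0 = 0"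
    and inj: "inj_on (\<lambda>i. hom_part 1 (y i)) {..<n}"
    and ind: "mpoly.independent ((\<lambda>i. hom_part 1 (y i)) ` {..<n})"
    and p: "p \<in> poly_ring n" "eval_poly const_poly y p = 0"
  shows "p = 0"
proof -
  let ?l = "\<lambda>i. hom_part 1 (y i)"
  \<comment> \<open>The values are prescribed only on the independent set of linear parts.
    Injectivity allows the index to be recovered from the linear part; elsewhere \<open>g\<close> is
    an arbitrary linear extension.\<close>
  obtain g where g: "Vector_Spaces.linear (\<lambda>c p. const_poly c * p) (\<lambda>c p. const_poly c * p) g"
      "\<And>v. v \<in> ?l ` {..<n} \<Longrightarrow> g v = var (inv_into {..<n} ?l v)"
    using mpoly.linear_independent_extend[OF ind, of "\<lambda>v. var (inv_into {..<n} ?l v)"] by blast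
  interpret g: Vector_Spaces.linear "\<lambda>c p. const_poly c * p" "\<lambda>c p. const_poly c * p" g
    by (rule g(1))
  have gl: "g (?l i) = var i" if "i < n" for i
    using that g(2)[of "?l i"] inv_into_f_f[OF inj, of i] by (simp del: One_nat_def)
  \<comment> \<open>The extension \<open>g\<close> may send a variable outside the linear forms, so
    only the linear part of its value is substituted. Hence \<open>\<tau>\<close> fixes the
    origin.\<close>
  define \<tau> where "\<tau> = eval_poly const_poly (\<lambda>j. hom_part 1 (g (var j)))"
  have \<tau>: "structure_map \<tau>" unfolding \<tau>_def
    by (rule eval_poly_structure[OF structure_map_const])
  have \<tau>_const: "\<tau> (const_poly c) = const_poly c" and \<tau>_var: "\<tau> (var j) = hom_part 1 (g (var j))" for c j
    by (simp_all add: \<tau>_def structure_map_const)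
  have \<tau>_0: "lookup (\<tau> q) 0 = lookup q 0" if "q \<in> poly_ring m" for q m
    using that
  proof (induction q rule: poly_ring_induct)
    case (var i)
    show ?case by (simp add: \<tau>_var lookup_hom_part) (simp add: var_def lookup_single)
  qed (simp_all add: \<tau>_const structure_map_simps[OF \<tau>] lookup_mult_0 lookup_add)
  \<comment> \<open>The chain rule at the origin: on linear parts the substitution acts through
    \<open>g\<close>. The product case is the Leibniz rule.\<close>
  have \<tau>_1: "hom_part 1 (\<tau> q) = hom_part 1 (g (hom_part 1 q))" if "q \<in> poly_ring m" for q m
    using that
  proof (induction q rule: poly_ring_induct)
    case (const c)
    then show ?case unfolding \<tau>_const hom_part_1_const g.zero by simp
  next
    case (var i)
    show ?case unfolding \<tau>_var hom_part_var hom_part_idem ..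
  next
    case (add p q)
    then show ?case by (simp add: structure_map_simps[OF \<tau>] hom_part_add g.add)
  next
    case (mult p q)
    have "hom_part 1 (\<tau> (p * q)) = const_poly (lookup p 0) * hom_part 1 (\<tau> q)
        + const_poly (lookup q 0) * hom_part 1 (\<tau> p)"
      unfolding structure_map_simps(3)[OF \<tau>] hom_part_1_mult \<tau>_0[OF mult.hyps(1)] \<tau>_0[OF mult.hyps(2)] ..
    also have "\<dots> = hom_part 1 (g (hom_part 1 (p * q)))"
      unfolding mult.IH hom_part_1_mult g.add g.scale hom_part_add hom_part_const_mult ..
    finally show ?case .
  qed
  have ring: "\<exists>m. q \<in> poly_ring m" for q :: "'k mpoly" by (rule poly_ring_exists)
  have "eval_poly const_poly (\<lambda>i. \<tau> (y i)) p = \<tau> (eval_poly const_poly y p)"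
    using eval_poly_comp[OF structure_map_const structure_map_const \<tau> \<tau>_const p(1)] by simp
  then have "eval_poly const_poly (\<lambda>i. \<tau> (y i)) p = 0"
    using p(2) by (simp add: structure_map_simps[OF \<tau>])
  moreover have "hom_part 1 (\<tau> (y i)) = var i" "lookup (\<tau> (y i)) 0 = 0" if i: "i < n" for i
  proof -
    obtain m where m: "y i \<in> poly_ring m" using ring by blast
    show "hom_part 1 (\<tau> (y i)) = var i" using \<tau>_1[OF m] gl[OF i] by (simp only: hom_part_var)
    show "lookup (\<tau> (y i)) 0 = 0" using \<tau>_0[OF m] y0[OF i] by simp
  qed
  ultimately show "p = 0"
    using tangent_to_identity_inj[of n "\<lambda>i. \<tau> (y i)", OF _ _ p(1)] by simp
qed

subsection \<open>Graded retracts of polynomial rings\<close>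

context positively_graded
begin

text \<open>Modulo the irrelevant ideal every \<open>w j\<close> is 0, so only the constant term of
  p remains.\<close>

lemma eval_poly_irrelevant:
  assumes w: "\<And>j. w j \<in> irrelevant" and p: "p \<in> poly_ring m"
  shows "eval_poly \<phi> w p - \<phi> (lookup p 0) \<in> irrelevant"
  using p
proof (induction p rule: poly_ring_induct)
  case (var i)
  show ?case
    using w by (simp add: \<phi>_structure \<phi>_simps var_def[of i] lookup_single eval_poly_single)
next
  case (add p q)
  then show ?case
    using irrelevant_add[OF add.IH]
    by (simp add: eval_poly_add[OF \<phi>_structure] lookup_add \<phi>_simps algebra_simps)
next
  case (mult p q)
  have "eval_poly \<phi> w (p * q) - \<phi> (lookup (p * q) 0) =
      eval_poly \<phi> w p * (eval_poly \<phi> w q - \<phi> (lookup q 0))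
      + \<phi> (lookup q 0) * (eval_poly \<phi> w p - \<phi> (lookup p 0))"
    by (simp add: eval_poly_mult[OF \<phi>_structure] lookup_mult_0 \<phi>_simps algebra_simps)
  then show ?case
    using mult.IH by (simp add: irrelevant_add irrelevant_mult)
qed (simp add: \<phi>_structure lookup_const)

lemma power_prod_irrelevant:
  assumes w: "\<And>j. w j \<in> irrelevant" and "t \<noteq> 0"
  shows "power_prod w t \<in> irrelevant"
proof -
  obtain s i where "t = s + single i 1" using decompose_power[OF assms(2)] by blast
  then show ?thesis using w by (simp add: power_prod_add irrelevant_mult)
qed

text \<open>Every monomial of p has degree at least two. After one variable is split off, the
  remaining monomial is still not 1, so both factors evaluate into the irrelevant ideal.\<close>

lemma eval_poly_irrelevant_square:
  assumes w: "\<And>j. w j \<in> irrelevant" and p: "lookup p 0 = 0" "hom_part 1 p = 0"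
  shows "eval_poly \<phi> w p \<in> irrelevant_square"
proof -
  have "\<phi> (lookup p t) * power_prod w t \<in> irrelevant_square" if "t \<in> keys p" for t
  proof -
    have "t \<noteq> 0" using that p(1) by (auto simp: in_keys_iff)
    then obtain s i where t: "t = s + single i 1" using decompose_power by blast
    have "lookup (hom_part 1 p) t = 0" by (simp only: p(2) lookup_zero)
    then have "mdeg t \<noteq> 1" using that by (auto simp: lookup_hom_part in_keys_iff)
    then have "s \<noteq> 0" by (auto simp: t)
    then have "w i * (\<phi> (lookup p t) * power_prod w s) \<in> irrelevant_square"
      using w by (intro irrelevant_square_mult irrelevant_mult power_prod_irrelevant)
    then show ?thesis by (simp add: t power_prod_add ac_simps)
  qed
  then have "(\<Sum>t\<in>S. \<phi> (lookup p t) * power_prod w t) \<in> irrelevant_square" if "S \<subseteq> keys p" for S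
    using that by (induction S rule: infinite_finite_induct)
      (auto intro: irrelevant_square.zero irrelevant_square_add)
  then show ?thesis unfolding eval_poly_def power_prod_def[symmetric] by blast
qed

text \<open>Evaluation at \<open>w\<close> is the retraction and \<open>\<iota>\<close> its section;
  that all \<open>w j\<close> are irrelevant means that the retraction maps the ideal of the origin
  into M. The number \<open>r\<close> is the dimension of the space of linear parts of M and is
  compared with the transcendence degree only later.\<close>

theorem graded_retract_polynomial:
  fixes \<iota> :: "'a \<Rightarrow> 'k mpoly"
  assumes \<iota>: "structure_map \<iota>" "\<And>c. \<iota> (\<phi> c) = const_poly c" "\<And>a. \<iota> a \<in> poly_ring N"
    and w: "\<And>j. w j \<in> irrelevant" and retract: "\<And>a. eval_poly \<phi> w (\<iota> a) = a"
  obtains r x where "alg_independent \<phi> r x" "\<And>a. \<exists>p\<in>poly_ring r. a = eval_poly \<phi> x p"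
proof -
  define L where "L a = hom_part 1 (\<iota> a)" for a
  have L_add: "L (a + b) = L a + L b" and L_diff: "L (a - b) = L a - L b"
    and L_scale: "L (\<phi> c * a) = const_poly c * L a" for a b c
    by (simp_all add: L_def structure_map_simps[OF \<iota>(1)] hom_part_add hom_part_diff \<iota>(2)
        hom_part_const_mult)
  have L_sum: "L (\<Sum>i\<in>S. f i) = (\<Sum>i\<in>S. L (f i))" for S and f :: "nat \<Rightarrow> 'a"
    using L_diff[of 0 0] by (induction S rule: infinite_finite_induct) (simp_all add: L_add)
  \<comment> \<open>Applying the retraction to \<open>\<iota> a\<close> shows that a agrees modulo M
    with the constant term of \<open>\<iota> a\<close>. For a in M this scalar lies in M, hence is
    0.\<close>
  have \<iota>_0: "lookup (\<iota> a) 0 = 0" if a: "a \<in> irrelevant" for a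
  proof -
    have "a - \<phi> (lookup (\<iota> a) 0) \<in> irrelevant"
      using eval_poly_irrelevant[of w, OF w \<iota>(3)[of a]] by (simp add: retract)
    then have "(- 1) * (a - \<phi> (lookup (\<iota> a) 0)) + a \<in> irrelevant"
      by (intro irrelevant_add irrelevant_mult a)
    then show ?thesis by (simp add: \<phi>_irrelevant)
  qed
  have square: "a \<in> irrelevant_square" if "a \<in> irrelevant" "L a = 0" for a
    using eval_poly_irrelevant_square[of w, OF w \<iota>_0[OF that(1)]] that(2) by (simp add: L_def retract)
  \<comment> \<open>The basis is drawn from linear parts of homogeneous elements, so that the lifts
    \<open>x i\<close> can be taken homogeneous.\<close>
  define H where "H = {a. \<exists>d>0. a \<in> G d}"
  have H: "H \<subseteq> irrelevant" by (auto simp: H_def irrelevant_homogeneous)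
  obtain B where B: "B \<subseteq> L ` H" "mpoly.independent B" "L ` H \<subseteq> mpoly.span B"
    using mpoly.maximal_independent_subset by blast
  \<comment> \<open>The linear forms in N variables are spanned by N elements, which makes the
    independent set \<open>B\<close> finite.\<close>
  have "B \<subseteq> mpoly.span (var ` {..<N})"
    using B(1) hom_part_1_span[OF \<iota>(3)] by (auto simp: L_def)
  then have "finite B" using mpoly.independent_span_bound[OF _ B(2)] by blast
  then obtain b where b: "bij_betw b {..<card B} B"
    using ex_bij_betw_nat_finite[of B] by (auto simp: atLeast0LessThan)
  define r where "r = card B"
  have "\<exists>a\<in>H. L a = b i" if "i < r" for i
  proof -
    have "b i \<in> L ` H" using that b B(1) by (auto simp: bij_betw_def r_def)
    then show ?thesis by force
  qed
  then obtain x where x: "\<And>i. i < r \<Longrightarrow> x i \<in> H" "\<And>i. i < r \<Longrightarrow> L (x i) = b i"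
    by metis
  have bx: "inj_on (\<lambda>i. L (x i)) {..<r}" "(\<lambda>i. L (x i)) ` {..<r} = B"
    using b x(2) inj_on_cong[of "{..<r}" "\<lambda>i. L (x i)" b]
      image_cong[of "{..<r}" "{..<r}" "\<lambda>i. L (x i)" b]
    by (simp_all add: bij_betw_def r_def)
  define C where "C = {eval_poly \<phi> x p |p. p \<in> poly_ring r}"
  have C: "eval_poly \<phi> x p \<in> C" if "p \<in> poly_ring r" for p
    using that by (auto simp: C_def)
  have C_const: "\<phi> c \<in> C" for c
    using C[OF poly_ring_const, of c] by (simp add: \<phi>_structure)
  have C_add: "u + v \<in> C" and C_mult: "u * v \<in> C" if uv: "u \<in> C" "v \<in> C" for u v
  proof -
    obtain p q where pq: "u = eval_poly \<phi> x p" "v = eval_poly \<phi> x q" "p \<in> poly_ring r" "q \<in> poly_ring r"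
      using uv by (auto simp: C_def)
    show "u + v \<in> C" "u * v \<in> C"
      using C[OF poly_ring_add[OF pq(3,4)]] C[OF poly_ring_mult[OF pq(3,4)]]
      by (simp_all add: pq eval_poly_add eval_poly_mult \<phi>_structure)
  qed
  have C_var: "x i \<in> C" if "i < r" for i
    using C[OF poly_ring_var[OF that]] by (simp add: \<phi>_structure)
  have C_0: "0 \<in> C" using C_const[of 0] by (simp add: \<phi>_simps)
  have C_sum: "sum f S \<in> C" if "\<And>i. i \<in> S \<Longrightarrow> f i \<in> C" for f :: "nat \<Rightarrow> 'a" and S
    using that by (induction S rule: infinite_finite_induct) (auto intro: C_0 C_add)
  have "a \<in> C" for a
  proof (rule graded_nakayama[of C])
    fix d :: int and a assume d: "d > 0" and a: "a \<in> G d"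
    then have aH: "a \<in> H" by (auto simp: H_def)
    then have "L a \<in> mpoly.span ((\<lambda>i. L (x i)) ` {..<r})"
      using B(3) by (auto simp: bx(2))
    then obtain u where "L a = (\<Sum>v\<in>(\<lambda>i. L (x i)) ` {..<r}. const_poly (u v) * v)"
      by (subst (asm) mpoly.span_finite) auto
    then have La: "L a = (\<Sum>i<r. const_poly (u (L (x i))) * L (x i))"
      by (simp add: sum.reindex[OF bx(1)])
    \<comment> \<open>A lift of the expansion of \<open>L a\<close> in the basis: \<open>a\<close>
      and \<open>e\<close> have the same linear part, so \<open>a - e\<close> lies in the square of
      M and serves as the element \<open>s\<close> required by
      \<open>graded_nakayama\<close>.\<close>
    define e where "e = (\<Sum>i<r. \<phi> (u (L (x i))) * x i)"
    have "L (a - e) = 0"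
      by (simp add: L_diff e_def L_sum L_scale La)
    moreover have "e \<in> irrelevant"
      unfolding e_def
    proof -
      have "(\<Sum>i\<in>S. \<phi> (u (L (x i))) * x i) \<in> irrelevant" if "S \<subseteq> {..<r}" for S
        using that x(1) H by (induction S rule: infinite_finite_induct)
          (auto intro!: irrelevant_add irrelevant_mult)
      then show "(\<Sum>i<r. \<phi> (u (L (x i))) * x i) \<in> irrelevant" by blast
    qed
    then have "a + (- 1) * e \<in> irrelevant"
      using aH H by (intro irrelevant_add irrelevant_mult) auto
    ultimately have "a - e \<in> irrelevant_square" by (intro square) auto
    \<comment> \<open>The element \<open>e\<close> may have components in several degrees. As each
      \<open>x i\<close> is homogeneous, its component of degree d is \<open>x i\<close> or
      0.\<close>
    moreover have "comp d (a - (a - e)) \<in> C"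
    proof -
      have "comp d (x i) \<in> C" if i: "i < r" for i
      proof -
        obtain j where "x i \<in> G j" using x(1)[OF i] by (auto simp: H_def)
        then show ?thesis using C_var[OF i] C_0 by (simp add: comp_homogeneous)
      qed
      then have "(\<Sum>i<r. \<phi> (u (L (x i))) * comp d (x i)) \<in> C"
        by (intro C_sum C_mult C_const) auto
      then show ?thesis by (simp add: e_def comp_sum comp_scale)
    qed
    ultimately show "\<exists>s\<in>irrelevant_square. comp d (a - s) \<in> C" by blast
  qed (fact C_const C_add C_mult)+
  then have gen: "\<exists>p\<in>poly_ring r. a = eval_poly \<phi> x p" for a
    by (auto simp: C_def)
  have "alg_independent \<phi> r x"
    unfolding alg_independent_def
  proof (intro ballI impI)
    fix p :: "'k mpoly" assume p: "p \<in> poly_ring r" "eval_poly \<phi> x p = 0"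
    \<comment> \<open>A relation among the \<open>x i\<close> is carried by \<open>\<iota>\<close>
      to a relation among polynomials whose linear parts form the basis \<open>B\<close>.\<close>
    have "eval_poly const_poly (\<lambda>i. \<iota> (x i)) p = \<iota> (eval_poly \<phi> x p)"
      using eval_poly_comp[OF \<phi>_structure structure_map_const \<iota>(1,2) p(1)] by simp
    then have 0: "eval_poly const_poly (\<lambda>i. \<iota> (x i)) p = 0"
      using p(2) by (simp add: structure_map_simps[OF \<iota>(1)])
    show "p = 0"
    proof (rule independent_linear_parts_imp_inj[OF _ bx(1)[unfolded L_def] _ p(1) 0])
      show "lookup (\<iota> (x i)) 0 = 0" if "i < r" for i
        using x(1)[OF that] H by (intro \<iota>_0) auto
      show "mpoly.independent ((\<lambda>i. hom_part 1 (\<iota> (x i))) ` {..<r})"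
        unfolding bx(2)[unfolded L_def] by (rule B(2))
    qed
  qed
  then show thesis using gen that by blast
qed

end

section \<open>Isomorphisms of algebras and the cancellation theorem\<close>

lemma k_isomorphic_sym:
  assumes iso: "k_isomorphic S \<phi> T \<psi>"
    and S: "\<And>a b. a \<in> S \<Longrightarrow> b \<in> S \<Longrightarrow> a + b \<in> S" "\<And>a b. a \<in> S \<Longrightarrow> b \<in> S \<Longrightarrow> a * b \<in> S"
      "\<And>c. \<phi> c \<in> S"
  shows "k_isomorphic T \<psi> S \<phi>"
proof -
  obtain f where f: "bij_betw f S T" "\<And>x y. x \<in> S \<Longrightarrow> y \<in> S \<Longrightarrow> f (x + y) = f x + f y"
      "\<And>x y. x \<in> S \<Longrightarrow> y \<in> S \<Longrightarrow> f (x * y) = f x * f y" "\<And>c. f (\<phi> c) = \<psi> c"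
    using iso unfolding k_isomorphic_def by blast
  let ?g = "inv_into S f"
  have g: "?g y \<in> S" "f (?g y) = y" if "y \<in> T" for y
    using that f(1) by (auto simp: bij_betw_def inv_into_into f_inv_into_f)
  have gf: "?g (f x) = x" if "x \<in> S" for x
    using that f(1) by (auto simp: bij_betw_def)
  have "?g (x + y) = ?g x + ?g y" "?g (x * y) = ?g x * ?g y" if "x \<in> T" "y \<in> T" for x y
    using gf[OF S(1)[OF g(1)[OF that(1)] g(1)[OF that(2)]]]
      gf[OF S(2)[OF g(1)[OF that(1)] g(1)[OF that(2)]]]
    by (simp_all add: f(2,3) g that)
  moreover have "?g (\<psi> c) = \<phi> c" for c
    using gf[OF S(3)] by (simp add: f(4))
  ultimately show ?thesis
    unfolding k_isomorphic_def by (intro exI[of _ ?g]) (auto intro: bij_betw_inv_into f(1))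
qed

lemma k_isomorphic_poly_ringI:
  assumes \<phi>: "structure_map \<phi>" and "alg_independent \<phi> n x"
    and "\<And>a. \<exists>p\<in>poly_ring n. a = eval_poly \<phi> x p"
  shows "k_isomorphic UNIV \<phi> (poly_ring n) const_poly"
proof -
  note hom = structure_map_simps[OF eval_poly_structure[OF \<phi>, of x]]
  have "inj_on (eval_poly \<phi> x) (poly_ring n)"
  proof (rule inj_onI)
    fix p q assume pq: "p \<in> poly_ring n" "q \<in> poly_ring n" "eval_poly \<phi> x p = eval_poly \<phi> x q"
    then have "eval_poly \<phi> x (p - q) = 0" by (simp add: hom)
    then show "p = q"
      using assms(2) poly_ring_diff[OF pq(1,2)] unfolding alg_independent_def by fastforce
  qed
  then have "bij_betw (eval_poly \<phi> x) (poly_ring n) UNIV"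
    using assms(3) by (auto simp: bij_betw_def)
  then have "k_isomorphic (poly_ring n) const_poly UNIV \<phi>"
    unfolding k_isomorphic_def by (intro exI[of _ "eval_poly \<phi> x"]) (auto simp: hom(2,3) \<phi>)
  then show ?thesis by (rule k_isomorphic_sym) auto
qed

text \<open>The retraction from B to A is the inverse \<open>g\<close> of \<open>f\<close> followed
  by the constant term in the m adjoined variables, and \<open>z\<close> lists its values on the
  variables of B. The section embeds A as constants and applies \<open>f\<close>.\<close>

theorem cancellation_of_positively_graded:
  fixes \<phi> :: "'k::field \<Rightarrow> 'a::idom"
  assumes \<phi>: "structure_map \<phi>" and n: "tr_deg \<phi> = enat n" and G: "positive_Z_grading \<phi> G"
    and iso: "k_isomorphic (poly_ring m) (\<lambda>c. const_poly (\<phi> c)) (poly_ring (n + m)) const_poly"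
  shows "k_isomorphic UNIV \<phi> (poly_ring n) const_poly"
proof -
  interpret positively_graded \<phi> G by standard (fact \<phi> G)+
  define N where "N = n + m"
  obtain f where f: "bij_betw f (poly_ring m :: 'a mpoly set) (poly_ring N :: 'k mpoly set)"
      "\<And>p q. p \<in> poly_ring m \<Longrightarrow> q \<in> poly_ring m \<Longrightarrow> f (p + q) = f p + f q"
      "\<And>p q. p \<in> poly_ring m \<Longrightarrow> q \<in> poly_ring m \<Longrightarrow> f (p * q) = f p * f q"
      "\<And>c. f (const_poly (\<phi> c)) = const_poly c"
    using iso unfolding k_isomorphic_def N_def by blast
  define g where "g = inv_into (poly_ring m) f"
  have fg: "g p \<in> poly_ring m" "f (g p) = p" if "p \<in> poly_ring N" for p
    using that f(1) by (auto simp: g_def bij_betw_def inv_into_into f_inv_into_f)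
  have gf: "g (f p) = p" if "p \<in> poly_ring m" for p
    using that f(1) by (auto simp: bij_betw_def g_def)
  have f_mem: "f p \<in> poly_ring N" if "p \<in> poly_ring m" for p
    using that f(1) by (auto simp: bij_betw_def)
  have g_hom: "g (p + q) = g p + g q" "g (p * q) = g p * g q"
    if "p \<in> poly_ring N" "q \<in> poly_ring N" for p q
    using gf[OF poly_ring_add[OF fg(1)[OF that(1)] fg(1)[OF that(2)]]]
      gf[OF poly_ring_mult[OF fg(1)[OF that(1)] fg(1)[OF that(2)]]]
    by (simp_all add: f(2,3) fg that)
  have g_const: "g (const_poly c) = const_poly (\<phi> c)" for c
    using gf[OF poly_ring_const, of "\<phi> c"] by (simp add: f(4))

  define z where "z i = lookup (g (var i)) 0" for i
  have z: "lookup (g p) 0 = eval_poly \<phi> z p" if "p \<in> poly_ring N" for p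
    unfolding z_def using poly_ring_hom_eq_eval_poly[OF \<phi> that, of "\<lambda>p. lookup (g p) 0"]
    by (simp add: g_hom lookup_add lookup_mult_0 g_const lookup_const)
  \<comment> \<open>The scalars \<open>c j\<close> are the coordinates of the k-rational point of
    affine space that the retraction assigns to M.\<close>
  have "\<exists>c. \<forall>j. z j - \<phi> (c j) \<in> irrelevant"
    using ex_scalar_part by (intro choice) blast
  then obtain c where c: "\<And>j. z j - \<phi> (c j) \<in> irrelevant" by blast
  define w where "w j = z j - \<phi> (c j)" for j
  \<comment> \<open>The translation moves the augmentation ideal to the origin of affine \<open>N\<close>-space.\<close>
  define y :: "nat \<Rightarrow> 'k mpoly" where "y j = var j + const_poly (c j)" for j
  define \<iota> where "\<iota> a = eval_poly const_poly y (f (const_poly a))" for a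
  have const_mem: "f (const_poly a) \<in> poly_ring N" for a by (simp add: f_mem)
  \<comment> \<open>The shift by \<open>c j\<close> in \<open>y\<close> undoes the one in
    \<open>w\<close>, so evaluation at \<open>w\<close> after the translation is the original
    retraction.\<close>
  have eval_w: "eval_poly \<phi> w (y i) = z i" for i
    by (simp add: y_def w_def eval_poly_add \<phi>)
  obtain r x where rx: "alg_independent \<phi> r x" "\<And>a. \<exists>p\<in>poly_ring r. a = eval_poly \<phi> x p"
  proof (rule graded_retract_polynomial[of \<iota> N w])
    have "f 1 = 1" using f(4)[of 1] by (simp add: \<phi>_simps)
    then have "structure_map (\<lambda>a. f (const_poly a))"
      by (simp add: structure_map_def f)
    then show "structure_map \<iota>"
      using eval_poly_structure[OF structure_map_const, of y] by (simp add: \<iota>_def structure_map_def)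
    show "\<iota> (\<phi> c) = const_poly c" for c
      by (simp add: \<iota>_def f(4) structure_map_const)
    show "\<iota> a \<in> poly_ring N" for a
      unfolding \<iota>_def y_def
      by (rule eval_poly_in_subalgebra[OF structure_map_const const_mem]) auto
    show "w j \<in> irrelevant" for j using c by (simp add: w_def)
    show "eval_poly \<phi> w (\<iota> a) = a" for a
    proof -
      have "eval_poly \<phi> w (\<iota> a) = eval_poly \<phi> (\<lambda>i. eval_poly \<phi> w (y i)) (f (const_poly a))"
        unfolding \<iota>_def
        by (rule eval_poly_comp[OF structure_map_const \<phi> eval_poly_structure[OF \<phi>] _ const_mem])
          (simp add: \<phi>)
      also have "\<dots> = lookup (g (f (const_poly a))) 0"
        by (simp add: eval_w z const_mem)
      also have "\<dots> = a" by (simp add: gf lookup_const)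
      finally show ?thesis .
    qed
  qed blast

  have "enat r \<le> tr_deg \<phi>"
    unfolding tr_deg_def using rx(1) by (intro Sup_upper) auto
  then have "r \<le> n" using n by simp
  \<comment> \<open>The span of the linear parts of generators of the image of \<open>f\<close>:
    those coming from the r generators of A and those coming from the m adjoined variables.\<close>
  define E where "E = mpoly.span ((\<lambda>i. hom_part 1 (f (const_poly (x i)))) ` {..<r} \<union>
    (\<lambda>j. hom_part 1 (f (var j))) ` {..<m})"
  \<comment> \<open>By the Leibniz rule the linear part of a product is a combination, with
    coefficients in k, of the linear parts of its factors, so linear parts of generators
    suffice.\<close>
  have E_add: "hom_part 1 (f (p + q)) \<in> E" and E_mult: "hom_part 1 (f (p * q)) \<in> E"
    if "p \<in> poly_ring m" "q \<in> poly_ring m" "hom_part 1 (f p) \<in> E" "hom_part 1 (f q) \<in> E" for p q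
    using that unfolding f(2,3)[OF that(1,2)] hom_part_add hom_part_1_mult E_def
    by (auto intro!: mpoly.span_add mpoly.span_scale)
  have E_const: "hom_part 1 (f (const_poly (eval_poly \<phi> x p))) \<in> E" if "p \<in> poly_ring r" for p
    using that
  proof (induction p rule: poly_ring_induct)
    case (const c)
    then show ?case unfolding eval_poly_const[OF \<phi>] f(4) hom_part_1_const
      by (simp add: E_def mpoly.span_zero)
  next
    case (var i)
    then show ?case unfolding eval_poly_var[OF \<phi>] E_def by (intro mpoly.span_base) auto
  next
    case (add p q)
    then show ?case unfolding eval_poly_add[OF \<phi>] const_poly_simps by (intro E_add) auto
  next
    case (mult p q)
    then show ?case unfolding eval_poly_mult[OF \<phi>] const_poly_simps by (intro E_mult) auto
  qed
  have E: "hom_part 1 (f p) \<in> E" if "p \<in> poly_ring m" for p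
    using that
  proof (induction p rule: poly_ring_induct)
    case (const a)
    obtain p where "p \<in> poly_ring r" "a = eval_poly \<phi> x p" using rx(2) by blast
    then show ?case using E_const by blast
  next
    case (var i)
    then show ?case unfolding E_def by (intro mpoly.span_base) auto
  qed (rule E_add E_mult; assumption)+
  \<comment> \<open>Since \<open>f\<close> is onto, each variable of B is the linear part of some
    \<open>f p\<close>. Thus N independent forms lie in a space spanned by r + m elements.\<close>
  have var_E: "var i \<in> E" if "i < N" for i
  proof -
    have "hom_part 1 (f (g (var i))) \<in> E" using that by (intro E fg) simp
    then show ?thesis using that by (simp only: fg(2) poly_ring_var hom_part_var)
  qed
  have "card (var ` {..<N} :: 'k mpoly set) \<le>
      card ((\<lambda>i. hom_part 1 (f (const_poly (x i)))) ` {..<r} \<union> (\<lambda>j. hom_part 1 (f (var j))) ` {..<m})"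
    by (rule conjunct2[OF mpoly.independent_span_bound[OF _ independent_vars]])
      (use var_E[unfolded E_def] in auto)
  also have "\<dots> \<le> card ((\<lambda>i. hom_part 1 (f (const_poly (x i)))) ` {..<r}) +
      card ((\<lambda>j. hom_part 1 (f (var j))) ` {..<m})"
    by (rule card_Un_le)
  also have "\<dots> \<le> r + m"
    by (intro add_mono order_trans[OF card_image_le]) simp_all
  finally have "N \<le> r + m"
    by (simp add: card_image inj_on_subset[OF inj_var])
  with \<open>r \<le> n\<close> have "r = n" by (simp add: N_def)
  then show ?thesis using k_isomorphic_poly_ringI[OF \<phi>] rx by blast
qed

subsection \<open>Factoriality of subrings\<close>

definition subring :: "'b::idom set \<Rightarrow> bool" where
  "subring S \<longleftrightarrow> 1 \<in> S \<and> (\<forall>a\<in>S. \<forall>b\<in>S. a - b \<in> S \<and> a * b \<in> S)"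

definition dvd_in :: "'b::idom set \<Rightarrow> 'b \<Rightarrow> 'b \<Rightarrow> bool" where
  "dvd_in S a b \<longleftrightarrow> (\<exists>c\<in>S. b = a * c)"

definition irreducible_in :: "'b::idom set \<Rightarrow> 'b \<Rightarrow> bool" where
  "irreducible_in S p \<longleftrightarrow> p \<in> S \<and> p \<noteq> 0 \<and> \<not> dvd_in S p 1 \<and>
     (\<forall>a\<in>S. \<forall>b\<in>S. p = a * b \<longrightarrow> dvd_in S a 1 \<or> dvd_in S b 1)"

definition prime_in :: "'b::idom set \<Rightarrow> 'b \<Rightarrow> bool" where
  "prime_in S p \<longleftrightarrow> p \<in> S \<and> p \<noteq> 0 \<and> \<not> dvd_in S p 1 \<and>
     (\<forall>a\<in>S. \<forall>b\<in>S. dvd_in S p (a * b) \<longrightarrow> dvd_in S p a \<or> dvd_in S p b)"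

definition length_function :: "'b::idom set \<Rightarrow> ('b \<Rightarrow> nat) \<Rightarrow> bool" where
  "length_function S l \<longleftrightarrow> (\<forall>a\<in>S. \<forall>b\<in>S. a \<noteq> 0 \<longrightarrow> b \<noteq> 0 \<longrightarrow> l (a * b) = l a + l b) \<and>
     (\<forall>a\<in>S. a \<noteq> 0 \<longrightarrow> (l a = 0 \<longleftrightarrow> dvd_in S a 1))"

text \<open>
  The length function stands in for existence of factorizations. On \<open>S[X]\<close> the degree plus the length
  of the leading coefficient is again such a function.
\<close>

definition factorial_subring :: "'b::idom set \<Rightarrow> bool" where
  "factorial_subring S \<longleftrightarrow> subring S \<and> (\<exists>l. length_function S l) \<and>
     (\<forall>p. irreducible_in S p \<longrightarrow> prime_in S p)"

lemma subringD:
  assumes "subring S"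
  shows "1 \<in> S" "0 \<in> S" "a \<in> S \<Longrightarrow> b \<in> S \<Longrightarrow> a - b \<in> S" "a \<in> S \<Longrightarrow> b \<in> S \<Longrightarrow> a * b \<in> S"
    "a \<in> S \<Longrightarrow> - a \<in> S" "a \<in> S \<Longrightarrow> b \<in> S \<Longrightarrow> a + b \<in> S"
proof -
  show *: "1 \<in> S" "a \<in> S \<Longrightarrow> b \<in> S \<Longrightarrow> a - b \<in> S" "a \<in> S \<Longrightarrow> b \<in> S \<Longrightarrow> a * b \<in> S" for a b
    using assms by (auto simp: subring_def)
  show z: "0 \<in> S" using *(2)[OF *(1) *(1)] by simp
  show m: "a \<in> S \<Longrightarrow> - a \<in> S" for a using *(2)[OF z] by simp
  show "a \<in> S \<Longrightarrow> b \<in> S \<Longrightarrow> a + b \<in> S" using *(2)[OF _ m, of a b] by simp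
qed

lemma dvd_in_mult:
  assumes "subring S" "dvd_in S a b" "c \<in> S"
  shows "dvd_in S a (b * c)" "dvd_in S a (c * b)"
  using assms by (auto simp: dvd_in_def mult.assoc mult.left_commute intro: subringD)

lemma dvd_in_diff: "subring S \<Longrightarrow> dvd_in S a b \<Longrightarrow> dvd_in S a c \<Longrightarrow> dvd_in S a (b - c)"
  by (auto simp: dvd_in_def intro: subringD simp flip: right_diff_distrib)

lemma dvd_in_0: "subring S \<Longrightarrow> dvd_in S a 0"
  using subringD(2) by (auto simp: dvd_in_def)

lemma dvd_in_sum: "subring S \<Longrightarrow> (\<And>i. i \<in> I \<Longrightarrow> dvd_in S a (f i)) \<Longrightarrow> dvd_in S a (sum f I)"
proof (induction I rule: infinite_finite_induct)
  case (insert i I)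
  then have "dvd_in S a (f i)" "dvd_in S a (sum f I)" by auto
  then have "dvd_in S a (f i + sum f I)"
    using insert.prems(1) by (auto simp: dvd_in_def intro: subringD simp flip: distrib_left)
  then show ?case using insert by simp
qed (auto intro: dvd_in_0)

lemma irreducible_inE:
  assumes "irreducible_in S p" "p = a * b" "a \<in> S" "b \<in> S"
  obtains c where "c \<in> S" "a * c = 1" | c where "c \<in> S" "b * c = 1"
  using assms by (auto simp: irreducible_in_def dvd_in_def) metis

subsection \<open>Polynomials over a factorial subring\<close>

definition polys_over :: "'b::idom set \<Rightarrow> 'b poly set" where
  "polys_over S = {p. \<forall>i. coeff p i \<in> S}"

locale factorial_coeffs =
  fixes S :: "'b::idom set"
  assumes factorial: "factorial_subring S"
begin

lemma S_subring: "subring S" using factorial by (simp add: factorial_subring_def)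

lemmas S_closed = subringD[OF S_subring]

lemma S_sum: "(\<And>i. i \<in> I \<Longrightarrow> f i \<in> S) \<Longrightarrow> sum f I \<in> S"
  by (induction I rule: infinite_finite_induct) (auto intro: S_closed)

abbreviation "T \<equiv> polys_over S"

lemma coeff_mem: "p \<in> T \<Longrightarrow> coeff p i \<in> S"
  by (simp add: polys_over_def)

lemma T_subring: "subring T"
  unfolding subring_def polys_over_def
  by (auto simp: coeff_1 coeff_mult intro!: S_closed S_sum)

lemmas T_closed = subringD[OF T_subring]

lemma const_mem_iff: "[:a:] \<in> T \<longleftrightarrow> a \<in> S"
  by (auto simp: polys_over_def coeff_pCons S_closed split: nat.split)

lemma smult_mem: "a \<in> S \<Longrightarrow> p \<in> T \<Longrightarrow> smult a p \<in> T"
  by (auto simp: polys_over_def S_closed)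

lemma unit_iff: "p \<in> T \<Longrightarrow> dvd_in T p 1 \<longleftrightarrow> (\<exists>a. p = [:a:] \<and> dvd_in S a 1)"
proof
  assume p: "p \<in> T" "dvd_in T p 1"
  then obtain q where q: "q \<in> T" "1 = p * q" by (auto simp: dvd_in_def)
  then have "p \<noteq> 0" "q \<noteq> 0" by auto
  then have "degree p + degree q = 0"
    using q(2) by (metis degree_1 degree_mult_eq)
  then obtain a b where "p = [:a:]" "q = [:b:]"
    by (metis add_is_0 degree_eq_zeroE)
  moreover from this have "b \<in> S" "1 = a * b"
    using q by (auto simp: const_mem_iff one_pCons mult.commute)
  ultimately show "\<exists>a. p = [:a:] \<and> dvd_in S a 1"
    by (auto simp: dvd_in_def)
next
  assume "\<exists>a. p = [:a:] \<and> dvd_in S a 1"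
  then obtain a b where "p = [:a:]" "b \<in> S" "1 = a * b" by (auto simp: dvd_in_def)
  then show "dvd_in T p 1"
    by (auto simp: dvd_in_def one_pCons const_mem_iff intro!: bexI[of _ "[:b:]"])
qed

lemma dvd_const_iff:
  assumes "p \<in> T"
  shows "dvd_in T [:a:] p \<longleftrightarrow> (\<forall>i. dvd_in S a (coeff p i))"
proof
  assume "\<forall>i. dvd_in S a (coeff p i)"
  then have "\<exists>c. \<forall>i. c i \<in> S \<and> coeff p i = a * c i"
    by (intro choice) (auto simp: dvd_in_def)
  then obtain c where c: "\<And>i. c i \<in> S" "\<And>i. coeff p i = a * c i" by blast
  \<comment> \<open>The cofactors \<open>c i\<close> come from a choice and may be nonzero above the
    degree of \<open>p\<close> when a = 0, so the sum is cut off there.\<close>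
  define q where "q = (\<Sum>i\<le>degree p. monom (c i) i)"
  have q: "coeff q i = (if i \<le> degree p then c i else 0)" for i
    by (simp add: q_def coeff_sum)
  then have "q \<in> T" using c by (simp add: polys_over_def S_closed)
  moreover have "p = [:a:] * q"
    using coeff_eq_0[of p] by (intro poly_eqI) (auto simp: q simp flip: c(2))
  ultimately show "dvd_in T [:a:] p" by (auto simp: dvd_in_def)
qed (auto simp: dvd_in_def coeff_mem)

text \<open>With i and j the least indices at which the coefficients of p and q are not divisible by
  a, every other term of the coefficient of the product at i + j is divisible by a.\<close>

lemma prime_const:
  assumes a: "prime_in S a"
  shows "prime_in T [:a:]"
proof -
  have "dvd_in T [:a:] p \<or> dvd_in T [:a:] q"
    if pq: "p \<in> T" "q \<in> T" "dvd_in T [:a:] (p * q)" for p q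
  proof (rule ccontr)
    assume "\<not> (dvd_in T [:a:] p \<or> dvd_in T [:a:] q)"
    then have ex: "\<exists>i. \<not> dvd_in S a (coeff p i)" "\<exists>i. \<not> dvd_in S a (coeff q i)"
      using pq by (auto simp: dvd_const_iff)
    define i where "i = (LEAST i. \<not> dvd_in S a (coeff p i))"
    define j where "j = (LEAST i. \<not> dvd_in S a (coeff q i))"
    have i: "\<not> dvd_in S a (coeff p i)" "\<And>k. k < i \<Longrightarrow> dvd_in S a (coeff p k)"
      unfolding i_def by (rule LeastI_ex[OF ex(1)]) (drule not_less_Least, simp)
    have j: "\<not> dvd_in S a (coeff q j)" "\<And>k. k < j \<Longrightarrow> dvd_in S a (coeff q k)"
      unfolding j_def by (rule LeastI_ex[OF ex(2)]) (drule not_less_Least, simp)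
    let ?t = "\<lambda>k. coeff p k * coeff q (i + j - k)"
    have "dvd_in S a (?t k)" if "k \<in> {..i + j} - {i}" for k
    proof (cases "k < i")
      case True
      then show ?thesis using i(2) pq by (intro dvd_in_mult[OF S_subring] coeff_mem)
    next
      case False
      then have "i + j - k < j" using that by auto
      then show ?thesis using j(2) pq by (intro dvd_in_mult[OF S_subring] coeff_mem)
    qed
    then have "dvd_in S a (\<Sum>k\<in>{..i + j} - {i}. ?t k)"
      by (intro dvd_in_sum[OF S_subring])
    moreover have "dvd_in S a (coeff (p * q) (i + j))"
      using pq T_closed(4) by (simp add: dvd_const_iff)
    moreover have "coeff (p * q) (i + j) = coeff p i * coeff q j + (\<Sum>k\<in>{..i + j} - {i}. ?t k)"
      by (simp add: coeff_mult sum.remove[of "{..i + j}" i])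
    ultimately have "dvd_in S a (coeff p i * coeff q j)"
      using dvd_in_diff[OF S_subring, of a "coeff (p * q) (i + j)" "\<Sum>k\<in>{..i + j} - {i}. ?t k"] by simp
    then show False
      using a i(1) j(1) pq coeff_mem unfolding prime_in_def by blast
  qed
  then show ?thesis
    using a by (auto simp: prime_in_def const_mem_iff unit_iff)
qed

lemma irreducible_imp_prime_coeff: "irreducible_in S a \<Longrightarrow> prime_in S a"
  using factorial by (simp add: factorial_subring_def)

text \<open>This takes the place of the multiplicativity of contents. An irreducible s is prime in
  S[X] by \<open>prime_const\<close> and therefore divides one of the factors; a reducible s is
  distributed piece by piece, by induction on its length.\<close>

lemma split_scalar:
  assumes "s \<in> S" "s \<noteq> 0" "f \<in> T" "p \<in> T" "q \<in> T" "smult s f = p * q"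
  shows "\<exists>a\<in>S. \<exists>b\<in>S. \<exists>p'\<in>T. \<exists>q'\<in>T. s = a * b \<and> p = smult a p' \<and> q = smult b q' \<and> f = p' * q'"
proof -
  obtain l where l: "length_function S l" using factorial by (auto simp: factorial_subring_def)
  show ?thesis
    using assms
  proof (induction "l s" arbitrary: s f p q rule: less_induct)
    case less
    show ?case
    proof (cases "dvd_in S s 1")
      case True
      then obtain u where u: "u \<in> S" "s * u = 1" by (auto simp: dvd_in_def)
      have "f = smult u (smult s f)" using u by (simp add: mult.commute)
      also have "\<dots> = smult u p * q" by (simp add: less.prems)
      finally have "f = smult u p * q" .
      moreover have "p = smult s (smult u p)" using u by simp
      ultimately show ?thesis
        using less.prems u S_closed(1)
        by (intro bexI[of _ s] bexI[of _ 1] bexI[of _ "smult u p"] bexI[of _ q])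
          (auto intro: smult_mem)
    next
      case nonunit: False
      show ?thesis
      proof (cases "irreducible_in S s")
        case True
        then have "prime_in T [:s:]" by (intro prime_const irreducible_imp_prime_coeff)
        moreover have "dvd_in T [:s:] (p * q)"
          using less.prems(3) by (auto simp: dvd_in_def simp flip: less.prems(6))
        ultimately have "dvd_in T [:s:] p \<or> dvd_in T [:s:] q"
          using less.prems by (auto simp: prime_in_def)
        then show ?thesis
        proof
          assume "dvd_in T [:s:] p"
          then obtain p' where p': "p' \<in> T" "p = smult s p'" by (auto simp: dvd_in_def)
          then have "smult s f = smult s (p' * q)" using less.prems(6) by simp
          then have "f = p' * q" using less.prems(2) by (simp only: smult_cancel)
          then show ?thesis
            using less.prems p' S_closed(1)
            by (intro bexI[of _ s] bexI[of _ 1] bexI[of _ p'] bexI[of _ q]) auto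
        next
          assume "dvd_in T [:s:] q"
          then obtain q' where q': "q' \<in> T" "q = smult s q'" by (auto simp: dvd_in_def)
          then have "smult s f = smult s (p * q')" using less.prems(6) by simp
          then have "f = p * q'" using less.prems(2) by (simp only: smult_cancel)
          then show ?thesis
            using less.prems q' S_closed(1)
            by (intro bexI[of _ 1] bexI[of _ s] bexI[of _ p] bexI[of _ q']) auto
        qed
      next
        case False
        then obtain a b where ab: "a \<in> S" "b \<in> S" "s = a * b" "\<not> dvd_in S a 1" "\<not> dvd_in S b 1"
          using nonunit less.prems by (auto simp: irreducible_in_def)
        then have "a \<noteq> 0" "b \<noteq> 0" using less.prems(2) by auto
        then have "l s = l a + l b" "l a \<noteq> 0" "l b \<noteq> 0"
          using l ab by (auto simp: length_function_def)
        then have less': "l a < l s" "l b < l s" by auto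
        \<comment> \<open>Both \<open>a\<close> and \<open>b\<close> have smaller length than
          \<open>s\<close>. First \<open>a\<close> is distributed with \<open>smult b f\<close> as
          the cofactor, then \<open>b\<close> over the two factors that remain.\<close>
        have "smult a (smult b f) = p * q" using less.prems(6) ab by simp
        then obtain a1 b1 p1 q1 where 1: "a1 \<in> S" "b1 \<in> S" "p1 \<in> T" "q1 \<in> T" "a = a1 * b1"
          "p = smult a1 p1" "q = smult b1 q1" "smult b f = p1 * q1"
          using less.hyps[OF less'(1) ab(1) \<open>a \<noteq> 0\<close> smult_mem[OF ab(2) less.prems(3)] less.prems(4,5)]
          by blast
        then obtain a2 b2 p2 q2 where 2: "a2 \<in> S" "b2 \<in> S" "p2 \<in> T" "q2 \<in> T" "b = a2 * b2"
          "p1 = smult a2 p2" "q1 = smult b2 q2" "f = p2 * q2"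
          using less.hyps[OF less'(2) ab(2) \<open>b \<noteq> 0\<close> less.prems(3) 1(3,4,8)]
          by blast
        have "s = (a1 * a2) * (b1 * b2)" "p = smult (a1 * a2) p2" "q = smult (b1 * b2) q2"
          using 1 2 ab by (simp_all add: algebra_simps)
        then show ?thesis
          using 1(1,2) 2(1-4,8) S_closed(4) by blast
      qed
    qed
  qed
qed

text \<open>Divisibility over the fraction field descends to S[X]. Splitting s between f and w
  writes f as a scalar times a factor \<open>f'\<close> of h. As f is not constant,
  \<open>f'\<close> is no unit, so irreducibility makes the scalar a unit and f divides h along with
  \<open>f'\<close>.\<close>

lemma dvd_of_smult:
  assumes f: "irreducible_in T f" "degree f > 0"
    and "s \<in> S" "s \<noteq> 0" "h \<in> T" "w \<in> T" "smult s h = f * w"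
  shows "dvd_in T f h"
proof -
  have fT: "f \<in> T" using f(1) by (simp add: irreducible_in_def)
  obtain a b f' w' where *: "a \<in> S" "b \<in> S" "f' \<in> T" "w' \<in> T" "s = a * b" "f = smult a f'"
    "w = smult b w'" "h = f' * w'"
    using split_scalar[OF assms(3-5) fT assms(6,7)] by blast
  have f_eq: "f = [:a:] * f'" using * by simp
  have "\<not> dvd_in T f' 1"
  proof
    assume "dvd_in T f' 1"
    then obtain e where "f' = [:e:]" using *(3) by (auto simp: unit_iff)
    then have "f = [:a * e:]" using *(6) by simp
    then show False using f(2) by simp
  qed
  then have "dvd_in T [:a:] 1"
    using f(1) *(1,3) f_eq by (auto simp: irreducible_in_def const_mem_iff)
  then obtain u where u: "u \<in> T" "1 = [:a:] * u" by (auto simp: dvd_in_def)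
  have "f' = ([:a:] * u) * f'" unfolding u(2)[symmetric] by simp
  also have "\<dots> = ([:a:] * f') * u" by (simp only: ac_simps)
  also have "\<dots> = f * u" by (simp only: f_eq)
  finally have "h = f * u * w'" using *(8) by simp
  then show ?thesis
    using * u by (auto simp: dvd_in_def mult.assoc intro!: bexI[of _ "u * w'"] T_closed)
qed

text \<open>Each step of the long division multiplies by the leading coefficient of d instead of
  dividing by it, and s collects these multipliers.\<close>

lemma pseudo_division:
  assumes "f \<in> T" "d \<in> T" "d \<noteq> 0"
  shows "\<exists>s\<in>S. \<exists>q\<in>T. \<exists>r\<in>T. s \<noteq> 0 \<and> smult s f = d * q + r \<and> (r = 0 \<or> degree r < degree d)"
  using assms(1)
proof (induction "degree f" arbitrary: f rule: less_induct)
  case less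
  show ?case
  proof (cases "f = 0 \<or> degree f < degree d")
    case True
    then show ?thesis
      using less.prems S_closed T_closed
      by (intro bexI[of _ 1] bexI[of _ 0] bexI[of _ f]) auto
  next
    case False
    define m where "m = monom (lead_coeff f) (degree f - degree d)"
    define f' where "f' = smult (lead_coeff d) f - d * m"
    have m: "m \<in> T" using less.prems by (auto simp: m_def polys_over_def S_closed)
    have f': "f' \<in> T" unfolding f'_def
      using assms(2) less.prems m by (intro T_closed smult_mem coeff_mem)
    have lc: "lead_coeff d \<in> S" "lead_coeff d \<noteq> 0" using assms by (auto intro: coeff_mem)
    have dm: "degree (d * m) = degree f"
      using False assms(3) by (simp add: m_def degree_mult_eq degree_monom_eq)
    have "coeff f' (degree f) = 0"
      using False assms(3) coeff_mult_degree_sum[of d m]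
      by (simp add: f'_def m_def degree_monom_eq)
    moreover have "degree f' \<le> degree f"
      unfolding f'_def by (rule degree_diff_le) (simp_all add: dm)
    \<comment> \<open>The zero case is separate because the zero polynomial has degree 0: when f is
      constant the degree cannot drop, and the cancelled coefficient forces
      \<open>f' = 0\<close>.\<close>
    ultimately have "f' = 0 \<or> degree f' < degree f"
      by (metis leading_coeff_0_iff le_neq_implies_less)
    then have "\<exists>s\<in>S. \<exists>q\<in>T. \<exists>r\<in>T. s \<noteq> 0 \<and> smult s f' = d * q + r \<and> (r = 0 \<or> degree r < degree d)"
    proof
      assume "f' = 0"
      then show ?thesis
        using S_closed T_closed by (intro bexI[of _ 1] bexI[of _ 0]) auto
    qed (use less.hyps f' in blast)
    then obtain s q r where *: "s \<in> S" "q \<in> T" "r \<in> T" "s \<noteq> 0" "smult s f' = d * q + r"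
      "r = 0 \<or> degree r < degree d" by blast
    have "smult (s * lead_coeff d) f = smult s f' + d * smult s m"
      by (simp add: f'_def smult_diff_right)
    also have "\<dots> = d * (q + smult s m) + r" using *(5) by (simp add: algebra_simps)
    finally show ?thesis
      using * lc m by (intro bexI[of _ "s * lead_coeff d"] bexI[of _ "q + smult s m"] bexI[of _ r])
        (auto intro!: S_closed T_closed smult_mem)
  qed
qed

text \<open>A constant irreducible is irreducible in S, hence prime there and in S[X]. For positive
  degree the Bezout argument over the fraction field is carried out up to nonzero scalars, which
  \<open>split_scalar\<close> and \<open>dvd_of_smult\<close> then remove.\<close>

lemma irreducible_imp_prime:
  assumes f: "irreducible_in T f"
  shows "prime_in T f"
proof (cases "degree f = 0")
  case True
  then obtain a where a: "f = [:a:]" by (rule degree_eq_zeroE)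
  have "irreducible_in S a"
    unfolding irreducible_in_def
  proof (intro conjI ballI impI)
    show "a \<in> S" "a \<noteq> 0" using f by (auto simp: irreducible_in_def a const_mem_iff)
    show "\<not> dvd_in S a 1" using f by (auto simp: irreducible_in_def a unit_iff)
    fix b c assume bc: "b \<in> S" "c \<in> S" "a = b * c"
    then have "[:b:] \<in> T" "[:c:] \<in> T" "f = [:b:] * [:c:]" by (auto simp: a const_mem_iff)
    then have "dvd_in T [:b:] 1 \<or> dvd_in T [:c:] 1" using f by (auto simp: irreducible_in_def)
    with \<open>[:b:] \<in> T\<close> \<open>[:c:] \<in> T\<close> show "dvd_in S b 1 \<or> dvd_in S c 1" by (auto simp: unit_iff)
  qed
  then show ?thesis unfolding a by (intro prime_const irreducible_imp_prime_coeff)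
next
  case False
  then have deg: "degree f > 0" by simp
  have fT: "f \<in> T" "f \<noteq> 0" using f by (auto simp: irreducible_in_def)
  have "dvd_in T f g \<or> dvd_in T f h" if gh: "g \<in> T" "h \<in> T" "dvd_in T f (g * h)" for g h
  proof -
    obtain k where k: "k \<in> T" "g * h = f * k" using gh(3) by (auto simp: dvd_in_def)
    \<comment> \<open>A nonzero element of least degree of the ideal \<open>(f, g)\<close> replaces the gcd over the fraction field.\<close>
    define I where "I = {u * f + v * g |u v. u \<in> T \<and> v \<in> T}"
    have IT: "I \<subseteq> T" using fT gh by (auto simp: I_def intro!: T_closed)
    have "1 * f + 0 * g \<in> I" "0 * f + 1 * g \<in> I"
      unfolding I_def using T_closed(1,2) by blast+
    then have I: "f \<in> I" "g \<in> I" by simp_all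
    have I_diff: "smult s i - j * q \<in> I" if ij: "i \<in> I" "j \<in> I" "s \<in> S" "q \<in> T" for s i j q
    proof -
      obtain u v u' v' where "u \<in> T" "v \<in> T" "u' \<in> T" "v' \<in> T" "i = u * f + v * g" "j = u' * f + v' * g"
        using ij(1,2) by (auto simp: I_def)
      moreover from this have "smult s i - j * q = (smult s u - u' * q) * f + (smult s v - v' * q) * g"
        by (simp add: algebra_simps smult_add_right)
      ultimately show ?thesis
        unfolding I_def using ij(3,4) by (blast intro: T_closed smult_mem)
    qed
    obtain d where d: "d \<in> I" "d \<noteq> 0" "\<And>e. e \<in> I \<Longrightarrow> e \<noteq> 0 \<Longrightarrow> degree d \<le> degree e"
    proof -
      have "\<exists>d. (d \<in> I \<and> d \<noteq> 0) \<and> (\<forall>e. e \<in> I \<and> e \<noteq> 0 \<longrightarrow> degree d \<le> degree e)"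
        using ex_has_least_nat[of "\<lambda>d. d \<in> I \<and> d \<noteq> 0" f degree] I fT(2) by blast
      then obtain d where "d \<in> I" "d \<noteq> 0" "\<forall>e. e \<in> I \<and> e \<noteq> 0 \<longrightarrow> degree d \<le> degree e"
        by (elim exE conjE)
      then show thesis by (intro that) auto
    qed
    have dT: "d \<in> T" using d(1) IT by blast
    \<comment> \<open>The pseudo-remainder of an element of the ideal by \<open>d\<close> lies in
      the ideal and has smaller degree or is 0; by minimality it is 0.\<close>
    have dvd_I: "\<exists>s\<in>S. \<exists>q\<in>T. s \<noteq> 0 \<and> smult s i = d * q" if i: "i \<in> I" for i
    proof -
      obtain s q r where *: "s \<in> S" "q \<in> T" "r \<in> T" "s \<noteq> 0" "smult s i = d * q + r"
        "r = 0 \<or> degree r < degree d"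
        using pseudo_division[OF _ dT d(2)] i IT by blast
      have "r \<in> I" using I_diff[OF i d(1) *(1,2)] *(5) by simp
      then have "r = 0" using *(6) d(3) by (meson not_le)
      then show ?thesis using * by auto
    qed
    obtain s q where sq: "s \<in> S" "q \<in> T" "s \<noteq> 0" "smult s f = d * q" using dvd_I[OF I(1)] by blast
    obtain s' q2 where sq2: "s' \<in> S" "q2 \<in> T" "s' \<noteq> 0" "smult s' g = d * q2"
      using dvd_I[OF I(2)] by blast
    \<comment> \<open>Clearing the scalar \<open>s\<close> yields a true factorization of
      \<open>f\<close> into \<open>d'\<close> and \<open>q'\<close>, to which irreducibility
      applies.\<close>
    obtain a b d' q' where *: "a \<in> S" "b \<in> S" "d' \<in> T" "q' \<in> T" "s = a * b" "d = smult a d'"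
      "q = smult b q'" "f = d' * q'"
      using split_scalar[OF sq(1,3) fT(1) dT sq(2,4)] by blast
    from f *(8,3,4) show ?thesis
    proof (cases rule: irreducible_inE)
      \<comment> \<open>Here \<open>f\<close> is associate to \<open>d'\<close>, so it divides
        \<open>d\<close>, and \<open>d\<close> divides a nonzero scalar multiple of
        \<open>g\<close>.\<close>
      case (2 c)
      have "d' = d' * (q' * c)" using 2 by simp
      then have "d' = f * c" using *(8) by (simp add: mult.assoc)
      then have "smult s' g = f * (smult a c * q2)"
        using sq2(4) *(6) by (simp add: mult.assoc)
      moreover have "smult a c * q2 \<in> T" using * 2 sq2 by (intro T_closed smult_mem)
      ultimately have "dvd_in T f g" using dvd_of_smult[OF f deg sq2(1,3) gh(1)] by blast
      then show ?thesis ..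
    next
      \<comment> \<open>Here \<open>d\<close> is a nonzero constant of the ideal. Multiplying its
        Bezout expression by \<open>h\<close> makes both terms divisible by \<open>f\<close>, since
        \<open>f\<close> divides \<open>g * h\<close>.\<close>
      case (1 c)
      then have "dvd_in T d' 1" by (auto simp: dvd_in_def intro!: bexI[of _ c])
      then obtain e where "d' = [:e:]" using *(3) by (auto simp: unit_iff)
      then have e: "d = [:a * e:]" using *(6) by simp
      then have ae: "a * e \<in> S" "a * e \<noteq> 0" using dT d(2) by (auto simp: const_mem_iff)
      obtain u v where uv: "u \<in> T" "v \<in> T" "d = u * f + v * g" using d(1) by (auto simp: I_def)
      have "smult (a * e) h = d * h" by (simp add: e)
      also have "\<dots> = u * f * h + v * (g * h)" by (simp add: uv algebra_simps)
      also have "\<dots> = f * (u * h + v * k)" by (simp add: k algebra_simps)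
      finally have "smult (a * e) h = f * (u * h + v * k)" .
      moreover have "u * h + v * k \<in> T" using uv gh k by (intro T_closed)
      ultimately have "dvd_in T f h" using dvd_of_smult[OF f deg ae gh(2)] by blast
      then show ?thesis ..
    qed
  qed
  then show ?thesis using f by (auto simp: prime_in_def irreducible_in_def)
qed

lemma factorial_polys_over: "factorial_subring T"
proof -
  obtain l where l: "length_function S l" using factorial by (auto simp: factorial_subring_def)
  have "length_function T (\<lambda>p. degree p + l (lead_coeff p))"
    unfolding length_function_def
  proof (intro conjI ballI impI)
    fix p q assume pq: "p \<in> T" "q \<in> T" "p \<noteq> 0" "q \<noteq> 0"
    then have "l (lead_coeff p * lead_coeff q) = l (lead_coeff p) + l (lead_coeff q)"
      using l coeff_mem by (simp add: length_function_def)
    then show "degree (p * q) + l (lead_coeff (p * q)) =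
        degree p + l (lead_coeff p) + (degree q + l (lead_coeff q))"
      unfolding lead_coeff_mult using degree_mult_eq[OF pq(3,4)] by simp
  next
    fix p assume p: "p \<in> T" "p \<noteq> 0"
    show "degree p + l (lead_coeff p) = 0 \<longleftrightarrow> dvd_in T p 1"
    proof
      assume *: "degree p + l (lead_coeff p) = 0"
      then obtain a where "p = [:a:]" by (auto elim: degree_eq_zeroE)
      then show "dvd_in T p 1"
        using * l p by (auto simp: unit_iff length_function_def const_mem_iff)
    next
      assume "dvd_in T p 1"
      then show "degree p + l (lead_coeff p) = 0"
        using l p by (auto simp: unit_iff length_function_def const_mem_iff)
    qed
  qed
  then show ?thesis
    unfolding factorial_subring_def using T_subring irreducible_imp_prime by blast
qed

end

subsection \<open>Factoriality of polynomial rings over a field\<close>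

lemma factorial_subring_iso:
  assumes factorial: "factorial_subring S" and f: "bij_betw f S T"
    and hom: "\<And>x y. x \<in> S \<Longrightarrow> y \<in> S \<Longrightarrow> f (x + y) = f x + f y"
      "\<And>x y. x \<in> S \<Longrightarrow> y \<in> S \<Longrightarrow> f (x * y) = f x * f y"
    and one: "f 1 = 1"
  shows "factorial_subring T"
proof -
  interpret factorial_coeffs S by standard (rule factorial)
  have T_eq: "T = f ` S" and inj: "\<And>x y. x \<in> S \<Longrightarrow> y \<in> S \<Longrightarrow> f x = f y \<longleftrightarrow> x = y"
    using f by (auto simp: bij_betw_def inj_on_def)
  have zero: "f 0 = 0" using hom(1)[OF S_closed(2,2)] by (simp only: add_0_right add_cancel_right_right)
  have diff: "f (x - y) = f x - f y" if "x \<in> S" "y \<in> S" for x y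
    using hom(1)[of "x - y" y] that S_closed(3) by simp
  have dvd: "dvd_in T (f x) (f y) \<longleftrightarrow> dvd_in S x y" if "x \<in> S" "y \<in> S" for x y
    using that by (auto simp: T_eq dvd_in_def inj S_closed simp flip: hom(2))
  have dvd1: "dvd_in T (f x) 1 \<longleftrightarrow> dvd_in S x 1" if "x \<in> S" for x
    using dvd[OF that S_closed(1)] by (simp add: one)
  have nz: "f x = 0 \<longleftrightarrow> x = 0" if "x \<in> S" for x
    using inj[OF that S_closed(2)] by (simp add: zero)
  have "subring T"
    unfolding subring_def T_eq
    using S_closed(1) one by (force simp flip: diff hom(2) intro: S_closed)
  moreover have "\<exists>l. length_function T l"
  proof -
    obtain l where l: "length_function S l" using factorial by (auto simp: factorial_subring_def)
    have "inv_into S f (f x) = x" if "x \<in> S" for x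
      using that f by (auto simp: bij_betw_def)
    then have "length_function T (l \<circ> inv_into S f)"
      using l unfolding length_function_def T_eq
      by (auto simp: nz S_closed dvd1[unfolded T_eq] simp flip: hom(2))
    then show ?thesis by blast
  qed
  moreover have "prime_in T p" if p: "irreducible_in T p" for p
  proof -
    obtain x where x: "p = f x" "x \<in> S" using p by (auto simp: irreducible_in_def T_eq)
    have "irreducible_in S x"
      using p unfolding irreducible_in_def x(1) T_eq
      by (auto simp: x(2) nz dvd1[unfolded T_eq] inj S_closed simp flip: hom(2))
    then have "prime_in S x" by (rule irreducible_imp_prime_coeff)
    have "dvd_in T p a \<or> dvd_in T p b" if ab: "a \<in> T" "b \<in> T" "dvd_in T p (a * b)" for a b
    proof -
      obtain y z where yz: "a = f y" "b = f z" "y \<in> S" "z \<in> S" using ab(1,2) by (auto simp: T_eq)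
      then have "dvd_in S x (y * z)"
        using ab(3) dvd[OF x(2) S_closed(4)[OF yz(3,4)]] by (simp add: x(1) hom(2))
      then have "dvd_in S x y \<or> dvd_in S x z"
        using \<open>prime_in S x\<close> yz by (simp add: prime_in_def)
      then show ?thesis using yz x by (simp add: dvd)
    qed
    then show ?thesis using p by (simp add: prime_in_def irreducible_in_def)
  qed
  ultimately show ?thesis unfolding factorial_subring_def by blast
qed

lemma subring_poly_ring: "subring (poly_ring n :: 'k::idom mpoly set)"
  by (auto simp: subring_def)

lemma poly_ring_0: "poly_ring 0 = range (const_poly :: 'r::comm_ring_1 \<Rightarrow> _)"
proof -
  have "p = const_poly (lookup p 0)" if "p \<in> poly_ring 0" for p :: "'r mpoly"
    using that by (intro poly_mapping_eqI) (auto simp: lookup_const poly_ring_def in_keys_iff)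
  then show ?thesis by auto
qed

text \<open>The polynomial \<open>c\<close> does not involve the variable of index n, so that
  variable has exponent exactly j in each monomial of the product. This reads off coefficients with
  respect to the last variable.\<close>

lemma lookup_mult_var_power:
  assumes c: "c \<in> poly_ring n" and t: "keys t \<subseteq> {..<n}"
  shows "lookup (c * var n ^ j) (t + single n i) = (if i = j then lookup c t else (0 :: 'k::comm_ring_1))"
proof -
  have var: "var n ^ j = single (single n j) (1 :: 'k)"
    by (induction j) (simp_all add: var_def mult_single flip: single_add)
  have iff: "s + single n j = t + single n i \<longleftrightarrow> s = t \<and> j = i" if "keys s \<subseteq> {..<n}" for s
  proof
    assume eq: "s + single n j = t + single n i"
    have "lookup s n = 0" "lookup t n = 0" using that t by (auto simp: in_keys_iff subset_iff)
    then have "j = i" using arg_cong[OF eq, of "\<lambda>u. lookup u n"] by (simp add: lookup_add)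
    with eq show "s = t \<and> j = i" by simp
  qed auto
  have "c * var n ^ j = (\<Sum>s\<in>keys c. single (s + single n j) (lookup c s))"
    by (subst sum_single_lookup[of c, symmetric]) (simp add: var sum_distrib_right mult_single)
  then have "lookup (c * var n ^ j) (t + single n i) =
      (\<Sum>s\<in>keys c. lookup (single (s + single n j) (lookup c s)) (t + single n i))"
    by (simp add: lookup_sum)
  also have "\<dots> = (\<Sum>s\<in>keys c. if s = t then (if i = j then lookup c t else 0) else 0)"
    using c by (intro sum.cong) (auto simp: poly_ring_def lookup_single when_def iff)
  also have "\<dots> = (if i = j then lookup c t else 0)"
    by (auto simp: in_keys_iff)
  finally show ?thesis .
qed

text \<open>Substituting the new variable identifies R[X] for R = \<open>poly_ring n\<close> with
  the ring in one more variable. The coefficients can be recovered from the value, and the image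
  contains the generators and is closed under sums and products.\<close>

lemma poly_var_bij:
  "bij_betw (\<lambda>p. poly p (var n)) (polys_over (poly_ring n)) (poly_ring (Suc n) :: 'k::idom mpoly set)"
proof -
  let ?T = "polys_over (poly_ring n) :: 'k mpoly poly set" and ?f = "\<lambda>p. poly p (var n) :: 'k mpoly"
  have coeff: "lookup (?f p) (t + single n i) = lookup (coeff p i) t"
    if "p \<in> ?T" "keys t \<subseteq> {..<n}" for p t i
  proof -
    have "lookup (?f p) (t + single n i) = (\<Sum>j\<le>degree p. if i = j then lookup (coeff p i) t else 0)"
      using that unfolding poly_altdef lookup_sum
      by (intro sum.cong) (auto simp: lookup_mult_var_power polys_over_def)
    also have "\<dots> = lookup (coeff p i) t"
      using coeff_eq_0[of p i] by (cases "i \<le> degree p") auto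
    finally show ?thesis .
  qed
  have "inj_on ?f ?T"
  proof (rule inj_onI)
    fix p q assume pq: "p \<in> ?T" "q \<in> ?T" "?f p = ?f q"
    have "lookup (coeff p i) t = lookup (coeff q i) t" for i t
    proof (cases "keys t \<subseteq> {..<n}")
      case True
      then show ?thesis using coeff[OF pq(1)] coeff[OF pq(2)] pq(3) by metis
    next
      case False
      have "t \<notin> keys (coeff r i)" if "r \<in> ?T" for r
        using that False unfolding polys_over_def poly_ring_def by blast
      then show ?thesis using pq(1,2) by (simp add: in_keys_iff)
    qed
    then show "p = q" by (intro poly_eqI poly_mapping_eqI)
  qed
  moreover have "?f p \<in> poly_ring (Suc n)" if p: "p \<in> ?T" for p
  proof -
    have pow: "var n ^ j \<in> (poly_ring (Suc n) :: 'k mpoly set)" for j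
      by (induction j) auto
    have "coeff p j \<in> poly_ring (Suc n)" for j
      using p by (rule_tac poly_ring_mono[of n]) (simp_all add: polys_over_def)
    then show ?thesis unfolding poly_altdef by (intro poly_ring_sum poly_ring_mult pow)
  qed
  moreover have "q \<in> ?f ` ?T" if "q \<in> poly_ring (Suc n)" for q
    using that
  proof (induction q rule: poly_ring_induct)
    case (const c)
    have "[:const_poly c:] \<in> ?T" by (auto simp: polys_over_def coeff_pCons split: nat.split)
    then show ?case by (rule rev_image_eqI) simp
  next
    case (var i)
    show ?case
    proof (cases "i = n")
      case True
      have "[:0, 1:] \<in> ?T" by (auto simp: polys_over_def coeff_pCons split: nat.split)
      then show ?thesis by (rule rev_image_eqI) (simp add: True)
    next
      case False
      then have "[:var i:] \<in> ?T" using var by (auto simp: polys_over_def coeff_pCons split: nat.split)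
      then show ?thesis by (rule rev_image_eqI) simp
    qed
  next
    case (add p q)
    then obtain p' q' where pq: "p' \<in> ?T" "q' \<in> ?T" "p = ?f p'" "q = ?f q'" by blast
    then have "p' + q' \<in> ?T" by (auto simp: polys_over_def)
    then show ?case by (rule rev_image_eqI) (simp add: pq)
  next
    case (mult p q)
    then obtain p' q' where pq: "p' \<in> ?T" "q' \<in> ?T" "p = ?f p'" "q = ?f q'" by blast
    then have "p' * q' \<in> ?T" by (auto simp: polys_over_def coeff_mult)
    then show ?case by (rule rev_image_eqI) (simp add: pq)
  qed
  ultimately show ?thesis unfolding bij_betw_def by blast
qed

lemma factorial_poly_ring: "factorial_subring (poly_ring n :: 'k::field mpoly set)"
proof (induction n)
  case 0
  \<comment> \<open>In zero variables the ring is the field k: all nonzero elements are units, so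
    the zero length function works and there are no irreducibles.\<close>
  have unit: "dvd_in (poly_ring 0) p 1" if "p \<in> poly_ring 0" "p \<noteq> 0" for p :: "'k mpoly"
  proof -
    obtain c where c: "p = const_poly c" using \<open>p \<in> poly_ring 0\<close> by (auto simp: poly_ring_0)
    then have "c \<noteq> 0" using \<open>p \<noteq> 0\<close> by auto
    then have "1 = p * const_poly (inverse c)" by (simp add: c flip: const_poly_simps)
    then show ?thesis by (auto simp: dvd_in_def)
  qed
  then have "length_function (poly_ring 0 :: 'k mpoly set) (\<lambda>_. 0)"
    by (simp add: length_function_def)
  moreover have "\<not> irreducible_in (poly_ring 0) p" for p :: "'k mpoly"
    using unit by (auto simp: irreducible_in_def)
  ultimately show ?case using subring_poly_ring by (auto simp: factorial_subring_def)
next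
  case (Suc n)
  interpret factorial_coeffs "poly_ring n :: 'k mpoly set" by standard (rule Suc)
  show ?case by (rule factorial_subring_iso[OF factorial_polys_over poly_var_bij]) auto
qed

text \<open>Factorizations exist by induction on the length, which drops strictly for both factors
  of a proper product. They are unique because irreducibles are prime.\<close>

lemma factorial_imp_ufd:
  assumes "factorial_subring (UNIV :: 'a::idom set)"
  shows "ufd TYPE('a)"
proof -
  have dvd: "dvd_in UNIV = ((dvd) :: 'a \<Rightarrow> _)"
    by (auto simp: fun_eq_iff dvd_in_def dvd_def)
  obtain l :: "'a \<Rightarrow> nat" where l: "length_function UNIV l"
    using assms by (auto simp: factorial_subring_def)
  have prime: "prime_elem p" if "irreducible p" for p :: 'a
    using assms that unfolding factorial_subring_def
    by (auto simp: irreducible_in_def prime_in_def dvd irreducible_def prime_elem_def)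
  have dvd_prod_mset_imp: "\<exists>q\<in>#N. p dvd q" if "prime_elem p" "p dvd prod_mset N" for p :: 'a and N
    using that(2)
  proof (induction N)
    case empty
    then show ?case using that(1) by (simp add: prime_elem_def)
  next
    case (add q N)
    then have "p dvd q \<or> p dvd prod_mset N" using that(1) by (simp add: prime_elem_def)
    then show ?case using add.IH by auto
  qed
  have "\<exists>M. (\<forall>p\<in>#M. irreducible p) \<and> a = prod_mset M" if "a \<noteq> 0" "\<not> a dvd 1" for a :: 'a
    using that
  proof (induction "l a" arbitrary: a rule: less_induct)
    case less
    show ?case
    proof (cases "irreducible a")
      case True
      then show ?thesis by (intro exI[of _ "{#a#}"]) simp
    next
      case False
      then obtain b c where bc: "a = b * c" "\<not> b dvd 1" "\<not> c dvd 1"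
        using less.prems by (auto simp: irreducible_def)
      then have "b \<noteq> 0" "c \<noteq> 0" using less.prems by auto
      then have "l a = l b + l c" "l b \<noteq> 0" "l c \<noteq> 0"
        using l bc by (auto simp: length_function_def dvd)
      then obtain M N where "\<forall>p\<in>#M. irreducible p" "b = prod_mset M"
          "\<forall>p\<in>#N. irreducible p" "c = prod_mset N"
        using less.hyps[of b] less.hyps[of c] bc \<open>b \<noteq> 0\<close> \<open>c \<noteq> 0\<close> by auto
      then show ?thesis using bc(1) by (intro exI[of _ "M + N"]) auto
    qed
  qed
  \<comment> \<open>The unit \<open>u\<close> keeps the induction going: cancelling p against a
    matching q = p * c leaves the unit c behind. Uniqueness itself is the case u = 1.\<close>
  moreover have "rel_mset (\<lambda>p q. p dvd q \<and> q dvd p) M N"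
    if "\<forall>p\<in>#M. irreducible p" "\<forall>q\<in>#N. irreducible q" "prod_mset M = u * prod_mset N" "u dvd 1"
    for M N and u :: 'a
    using that
  proof (induction M arbitrary: N u)
    case empty
    have "N = {#}"
    proof (rule ccontr)
      assume "N \<noteq> {#}"
      then obtain q where q: "q \<in># N" by blast
      then have "q dvd u * prod_mset N" by (intro dvd_mult dvd_prod_mset)
      then have "q dvd 1" using empty.prems(3) by simp
      then show False using q empty.prems(2) by (auto simp: irreducible_def)
    qed
    then show ?case by (simp add: rel_mset_Zero)
  next
    case (add p M)
    have p: "prime_elem p" "irreducible p" using add.prems(1) prime by auto
    have "\<not> p dvd u" using p add.prems(4) dvd_trans by (auto simp: prime_elem_def)
    moreover have "p dvd u * prod_mset N" using add.prems(3) by (metis dvd_triv_left prod_mset.add_mset)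
    ultimately have "p dvd prod_mset N" using prime_elem_dvd_multD[OF p(1)] by blast
    then obtain q where q: "q \<in># N" "p dvd q" using dvd_prod_mset_imp[OF p(1)] by blast
    then obtain N' where N: "N = add_mset q N'" by (meson multi_member_split)
    obtain c where c: "q = p * c" using q(2) by blast
    have "c dvd 1" using q(1) add.prems(2) c p by (auto simp: irreducible_def)
    then obtain c' where "1 = c * c'" by blast
    then have "p = q * c'" using c by (simp add: mult.assoc)
    then have "q dvd p" by simp
    have "p * prod_mset M = p * ((u * c) * prod_mset N')"
      using add.prems(3) by (simp add: N c ac_simps)
    then have "prod_mset M = (u * c) * prod_mset N'"
      using p by (simp add: prime_elem_def)
    moreover have "u * c dvd 1" using mult_dvd_mono[OF add.prems(4) \<open>c dvd 1\<close>] by simp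
    ultimately have "rel_mset (\<lambda>p q. p dvd q \<and> q dvd p) M N'"
      using add.prems by (intro add.IH) (auto simp: N)
    then show ?case unfolding N using q(2) \<open>q dvd p\<close> by (intro rel_mset_Plus) auto
  qed
  from this[of _ _ 1] have "\<forall>M N :: 'a multiset.
      (\<forall>p\<in>#M. irreducible p) \<and> (\<forall>q\<in>#N. irreducible q) \<and> prod_mset M = prod_mset N \<longrightarrow>
      rel_mset (\<lambda>p q. p dvd q \<and> q dvd p) M N" by simp
  ultimately show ?thesis unfolding ufd_def by blast
qed

subsection \<open>The standard grading\<close>

text \<open>The grading by total degree, pulled back along the isomorphism \<open>f\<close>; the
  component of index i of a corresponds to \<open>hom_part i (f a)\<close>.\<close>

lemma standard_grading:
  fixes \<phi> :: "'k::field \<Rightarrow> 'a::idom"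
  assumes f: "bij_betw f UNIV (poly_ring n :: 'k mpoly set)"
    and add: "\<And>x y. f (x + y) = f x + f y" and mult: "\<And>x y. f (x * y) = f x * f y"
    and const: "\<And>c. f (\<phi> c) = const_poly c"
  shows "positive_Z_grading \<phi> (\<lambda>i. {a. \<forall>t\<in>keys (f a). int (mdeg t) = i})"
    (is "positive_Z_grading \<phi> ?G")
proof -
  have inj: "f x = f y \<longleftrightarrow> x = y" for x y using f by (auto simp: bij_betw_def inj_on_def)
  have surj: "p \<in> poly_ring n \<Longrightarrow> \<exists>x. f x = p" for p using f by (metis bij_betw_imp_surj_on f imageE)
  have mem: "f x \<in> poly_ring n" for x using f by (auto simp: bij_betw_def)
  have zero: "f 0 = 0" using add[of 0 0] by (simp only: add_0_right add_cancel_right_right)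
  have diff: "f (x - y) = f x - f y" for x y using add[of "x - y" y] by (simp add: algebra_simps)
  have sum: "f (sum g I) = (\<Sum>i\<in>I. f (g i))" for g :: "int \<Rightarrow> 'a" and I
    by (induction I rule: infinite_finite_induct) (simp_all add: zero add)
  have G_iff: "a \<in> ?G i \<longleftrightarrow> (\<forall>t. int (mdeg t) \<noteq> i \<longrightarrow> lookup (f a) t = 0)" for a i
    by (auto simp: in_keys_iff)
  have "0 \<in> ?G i" "a \<in> ?G i \<Longrightarrow> b \<in> ?G i \<Longrightarrow> a - b \<in> ?G i" for i a b
    unfolding G_iff by (simp_all add: zero diff lookup_minus)
  moreover have "a * b \<in> ?G (i + j)" if "a \<in> ?G i" "b \<in> ?G j" for a b i j
  proof -
    have "int (mdeg t) = i + j" if "t \<in> keys (f a * f b)" for t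
      using that keys_mult[of "f a" "f b"] \<open>a \<in> ?G i\<close> \<open>b \<in> ?G j\<close> by (fastforce simp: mdeg_add)
    then show ?thesis by (simp add: mult)
  qed
  moreover have "\<exists>!h :: int \<Rightarrow>\<^sub>0 'a. (\<forall>i. lookup h i \<in> ?G i) \<and> a = (\<Sum>i\<in>keys h. lookup h i)" for a
  proof -
    have "\<exists>c. \<forall>i. f (c i) = hom_part i (f a)"
      by (intro choice allI surj hom_part_poly_ring mem)
    then obtain c where c: "\<And>i. f (c i) = hom_part i (f a)" by blast
    \<comment> \<open>Total degrees are natural numbers while the grading is indexed by integers, so
      negative indices receive 0.\<close>
    define g where "g i = (if i < 0 then 0 else c (nat i))" for i :: int
    have fg: "lookup (f (g i)) t = (if int (mdeg t) = i then lookup (f a) t else 0)" for i t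
      by (auto simp: g_def zero c lookup_hom_part)
    have "g i = 0" if "i \<notin> (\<lambda>t. int (mdeg t)) ` keys (f a)" for i
    proof -
      have "f (g i) = f 0"
        using that by (intro poly_mapping_eqI) (auto simp: fg zero in_keys_iff)
      then show ?thesis by (simp add: inj)
    qed
    then have "{i. g i \<noteq> 0} \<subseteq> (\<lambda>t. int (mdeg t)) ` keys (f a)" by blast
    then have fin: "finite {i. g i \<noteq> 0}" by (rule finite_subset) simp
    have h: "lookup (Abs_poly_mapping g) i = g i" for i using fin by simp
    show ?thesis
    proof (rule ex1I[of _ "Abs_poly_mapping g"], intro conjI allI)
      show "lookup (Abs_poly_mapping g) i \<in> ?G i" for i
        unfolding G_iff h by (simp add: fg)
      let ?K = "keys (Abs_poly_mapping g)"
      have "f a = (\<Sum>i\<in>?K. f (g i))"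
      proof (rule poly_mapping_eqI)
        fix t
        have "lookup (\<Sum>i\<in>?K. f (g i)) t = (\<Sum>i\<in>?K. if int (mdeg t) = i then lookup (f a) t else 0)"
          by (simp add: lookup_sum fg)
        also have "\<dots> = lookup (f a) t"
        proof (cases "int (mdeg t) \<in> ?K")
          case False
          then have "f (g (int (mdeg t))) = 0" by (simp add: in_keys_iff h zero)
          then have "lookup (f a) t = 0" using fg[of "int (mdeg t)" t] by simp
          then show ?thesis by simp
        qed simp
        finally show "lookup (f a) t = lookup (\<Sum>i\<in>?K. f (g i)) t" ..
      qed
      then show "a = (\<Sum>i\<in>?K. lookup (Abs_poly_mapping g) i)"
        unfolding h by (simp add: inj flip: sum)
    next
      fix h :: "int \<Rightarrow>\<^sub>0 'a"
      assume h: "(\<forall>i. lookup h i \<in> ?G i) \<and> a = (\<Sum>i\<in>keys h. lookup h i)"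
      then have hG: "lookup (f (lookup h i)) t = 0" if "int (mdeg t) \<noteq> i" for i t
        using that G_iff by blast
      have "f a = (\<Sum>i\<in>keys h. f (lookup h i))" using h sum by metis
      then have fa: "lookup (f a) t = (\<Sum>i\<in>keys h. lookup (f (lookup h i)) t)" for t
        by (simp add: lookup_sum)
      \<comment> \<open>In any decomposition a monomial t can come only from the summand of index
        \<open>mdeg t\<close>, so all coefficients of all summands are determined by
        \<open>f a\<close>.\<close>
      have "lookup (f a) t = (\<Sum>i\<in>keys h. if i = int (mdeg t) then lookup (f (lookup h i)) t else 0)" for t
        unfolding fa using hG by (intro sum.cong) auto
      then have "lookup (f a) t = lookup (f (lookup h (int (mdeg t)))) t" for t
        by (auto simp: in_keys_iff zero)
      then have "f (lookup h i) = f (g i)" for i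
        using hG by (intro poly_mapping_eqI) (auto simp: fg)
      then show "h = Abs_poly_mapping g"
        using fin by (intro poly_mapping_eqI) (simp add: inj)
    qed
  qed
  moreover have "range \<phi> \<subseteq> ?G 0"
    by (auto simp: const const_poly_def split: if_splits)
  moreover have "?G i = {0}" if "i < 0" for i
  proof -
    have "a = 0" if "a \<in> ?G i" for a
    proof -
      have "f a = f 0" using that \<open>i < 0\<close> unfolding G_iff
        by (intro poly_mapping_eqI) (auto simp: zero)
      then show ?thesis by (simp add: inj)
    qed
    then show ?thesis using \<open>0 \<in> ?G i\<close> by blast
  qed
  moreover have "?G 0 \<subseteq> range \<phi>"
  proof
    fix a assume a: "a \<in> ?G 0"
    have "f a = const_poly (lookup (f a) 0)"
      using a unfolding G_iff by (intro poly_mapping_eqI) (auto simp: lookup_const)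
    then have "f a = f (\<phi> (lookup (f a) 0))" by (simp add: const)
    then show "a \<in> range \<phi>" unfolding inj by blast
  qed
  ultimately show ?thesis
    unfolding positive_Z_grading_def Z_grading_def by blast
qed

text \<open>A polynomial in no variables is its constant term. This supplies m = 0 as the witness
  for stable triviality.\<close>

lemma k_isomorphic_poly_ring_0:
  fixes \<phi> :: "'k::field \<Rightarrow> 'a::idom"
  assumes "k_isomorphic (UNIV :: 'a set) \<phi> T \<psi>"
  shows "k_isomorphic (poly_ring 0) (\<lambda>c. const_poly (\<phi> c)) T \<psi>"
proof -
  obtain f where f: "bij_betw f UNIV T" "\<And>x y. f (x + y) = f x + f y"
      "\<And>x y. f (x * y) = f x * f y" "\<And>c. f (\<phi> c) = \<psi> c"
    using assms unfolding k_isomorphic_def by blast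
  have "bij_betw (\<lambda>p. lookup p 0) (poly_ring 0) (UNIV :: 'a set)"
    by (rule bij_betw_byWitness[of _ const_poly]) (auto simp: poly_ring_0 lookup_const)
  then have "bij_betw (\<lambda>p. f (lookup p 0)) (poly_ring 0) T"
    using bij_betw_trans[OF _ f(1)] by (force simp: o_def)
  then show ?thesis
    unfolding k_isomorphic_def
    by (intro exI[of _ "\<lambda>p. f (lookup p 0)"]) (auto simp: f lookup_add lookup_mult_0 lookup_const)
qed

theorem theorem6p4:
  fixes \<phi> :: "'k::field \<Rightarrow> 'a::idom" and n :: nat
  assumes affine: "affine_domain \<phi>"
    and dim: "tr_deg \<phi> = enat n"
  shows "(in_U_graded n \<phi> \<and>
          (\<exists>m::nat. k_isomorphic
             (poly_ring m :: 'a mpoly set) (\<lambda>c. const_poly (\<phi> c))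
             (poly_ring (n + m) :: 'k mpoly set) const_poly))
     \<longleftrightarrow> k_isomorphic (UNIV :: 'a set) \<phi> (poly_ring n :: 'k mpoly set) const_poly"
proof
  assume "in_U_graded n \<phi> \<and> (\<exists>m::nat. k_isomorphic (poly_ring m :: 'a mpoly set)
    (\<lambda>c. const_poly (\<phi> c)) (poly_ring (n + m) :: 'k mpoly set) const_poly)"
  then show "k_isomorphic (UNIV :: 'a set) \<phi> (poly_ring n :: 'k mpoly set) const_poly"
    using cancellation_of_positively_graded[OF _ dim] by (auto simp: in_U_graded_def)
next
  assume iso: "k_isomorphic (UNIV :: 'a set) \<phi> (poly_ring n :: 'k mpoly set) const_poly"
  then obtain f where f: "bij_betw f UNIV (poly_ring n :: 'k mpoly set)" "\<And>x y. f (x + y) = f x + f y"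
      "\<And>x y. f (x * y) = f x * f y" "\<And>c. f (\<phi> c) = const_poly c"
    unfolding k_isomorphic_def by blast
  have \<phi>: "structure_map \<phi>" using affine by (simp add: affine_domain_def)
  \<comment> \<open>Unique factorization is transported from the polynomial ring to A, against the
    direction of \<open>f\<close>.\<close>
  have "k_isomorphic (poly_ring n :: 'k mpoly set) const_poly (UNIV :: 'a set) \<phi>"
    using iso by (rule k_isomorphic_sym) auto
  then obtain g where g: "bij_betw g (poly_ring n :: 'k mpoly set) (UNIV :: 'a set)"
      "\<And>p q. p \<in> poly_ring n \<Longrightarrow> q \<in> poly_ring n \<Longrightarrow> g (p + q) = g p + g q"
      "\<And>p q. p \<in> poly_ring n \<Longrightarrow> q \<in> poly_ring n \<Longrightarrow> g (p * q) = g p * g q"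
      "\<And>c. g (const_poly c) = \<phi> c"
    unfolding k_isomorphic_def by blast
  have "g 1 = 1" using g(4)[of 1] structure_map_simps(1)[OF \<phi>] by simp
  then have "factorial_subring (UNIV :: 'a set)"
    using factorial_subring_iso[OF factorial_poly_ring g(1-3)] by blast
  then have "in_U_graded n \<phi>"
    using \<phi> dim factorial_imp_ufd standard_grading[OF f] by (auto simp: in_U_graded_def)
  moreover have "k_isomorphic (poly_ring 0 :: 'a mpoly set) (\<lambda>c. const_poly (\<phi> c))
      (poly_ring (n + 0) :: 'k mpoly set) const_poly"
    using k_isomorphic_poly_ring_0[OF iso] by simp
  ultimately show "in_U_graded n \<phi> \<and> (\<exists>m::nat. k_isomorphic (poly_ring m :: 'a mpoly set)
    (\<lambda>c. const_poly (\<phi> c)) (poly_ring (n + m) :: 'k mpoly set) const_poly)" by blast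
qed

end
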